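(* Let $\mathcal{H}$ be a complex Hilbert space, let $n$ be a positive integer, and let $A_{ij}\in\mathcal{B}(\mathcal{H})$ for all $i,j=1,2,\ldots,n$. Let $f,g:[0,\infty)\to[0,\infty)$ be continuous functions satisfying $f(\lambda)g(\lambda)=\lambda$ for all $\lambda\in[0,\infty)$. Then $$w\left(\begin{bmatrix} A_{11}&A_{12}&\ldots&A_{1n}\\ A_{21}&A_{22}&\ldots&A_{2n}\\ \vdots&\vdots& &\vdots\\ A_{n1}&A_{n2}&\ldots&A_{nn}\end{bmatrix}\right)\leq w\left(\begin{bmatrix} w(A_{11})&a_{12}&\ldots&a_{1n}\\ 0&w(A_{22})&\ldots&a_{2n}\\ \vdots&\vdots& &\vdots\\ 0&0&\ldots&w(A_{nn})\end{bmatrix}\right),$$ where the matrix on the right is the upper triangular $n\times n$ complex matrix with diagonal entries $w(A_{ii})$ and, for $i<j$, $(i,j)$ entry $$a_{ij}=\left\|f^2(|A_{ij}|)+g^2(|A_{ji}^*|)\right\|^{1/2}\left\|f^2(|A_{ji}|)+g^2(|A_{ij}^*|)\right\|^{1/2}.$$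
   Context: $\mathcal{B}(\mathcal{H})$ is the algebra of bounded linear operators on $\mathcal{H}$ with operator norm $\|\cdot\|$. For $A\in\mathcal{B}(\mathcal{H})$, $|A|=(A^*A)^{1/2}$ and $|A^*|=(AA^* )^{1/2}$, and the numerical radius is $w(A)=\sup\{|\langle Ax,x\rangle|: x\in\mathcal{H},\ \|x\|=1\}$. The operator matrix $[A_{ij}]$ acts as a bounded operator on the Hilbert space direct sum $\oplus_{i=1}^n\mathcal{H}$, and its numerical radius is taken there; an $n\times n$ complex matrix is viewed as an operator on $\mathbb{C}^n$ with its standard inner product. For a positive operator $T$, $f(T)$ and $g(T)$ are given by the continuous functional calculus, and $f^2(T)=(f(T))^2$, $g^2(T)=(g(T))^2$. *)

theory Defs
  imports "HOL-Analysis.Analysis" "HOL-Computational_Algebra.Polynomial"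
begin

text \<open>Complex Hilbert spaces; the inner product is linear in the first argument. The norm and
  the real scalar multiplication of the underlying Banach space are those induced by \<open>cinner\<close>
  and \<open>scaleC\<close>. Definiteness of \<open>cinner\<close> follows from \<open>norm_eq_sqrt_cinner\<close>.\<close>

class chilbert_space = banach +
  fixes scaleC :: "complex \<Rightarrow> 'a \<Rightarrow> 'a" (infixr \<open>*\<^sub>C\<close> 75)
    and cinner :: "'a \<Rightarrow> 'a \<Rightarrow> complex"
  assumes scaleC_add_right: "c *\<^sub>C (x + y) = c *\<^sub>C x + c *\<^sub>C y"
    and scaleC_add_left: "(c + d) *\<^sub>C x = c *\<^sub>C x + d *\<^sub>C x"
    and scaleC_scaleC: "c *\<^sub>C d *\<^sub>C x = (c * d) *\<^sub>C x"
    and scaleC_of_real: "complex_of_real r *\<^sub>C x = r *\<^sub>R x"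
    and cinner_commute: "cinner x y = cnj (cinner y x)"
    and cinner_add_left: "cinner (x + y) z = cinner x z + cinner y z"
    and cinner_scaleC_left: "cinner (c *\<^sub>C x) y = c * cinner x y"
    and cinner_self_nonneg: "0 \<le> Re (cinner x x)"
    and norm_eq_sqrt_cinner: "norm x = sqrt (Re (cinner x x))"

instantiation complex :: chilbert_space
begin

definition scaleC_complex :: "complex \<Rightarrow> complex \<Rightarrow> complex"
  where "scaleC_complex c x = c * x"

definition cinner_complex :: "complex \<Rightarrow> complex \<Rightarrow> complex"
  where "cinner_complex x y = x * cnj y"

instance
  by standard
    (auto simp: scaleC_complex_def cinner_complex_def algebra_simps scaleR_conv_of_real
      cmod_def power2_eq_square)

end

text \<open>The Hilbert space direct sum of copies of one space, indexed by a finite type. With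
  summand \<^typ>\<open>complex\<close> this is the standard \<open>n\<close>-dimensional complex inner product space.\<close>

instantiation vec :: (chilbert_space, finite) chilbert_space
begin

definition scaleC_vec :: "complex \<Rightarrow> 'a ^ 'b \<Rightarrow> 'a ^ 'b"
  where "scaleC_vec c x = (\<chi> i. c *\<^sub>C (x $ i))"

definition cinner_vec :: "'a ^ 'b \<Rightarrow> 'a ^ 'b \<Rightarrow> complex"
  where "cinner_vec x y = (\<Sum>i\<in>UNIV. cinner (x $ i) (y $ i))"

instance
proof
  fix c d :: complex and r :: real and x y z :: "'a ^ 'b"
  show "c *\<^sub>C (x + y) = c *\<^sub>C x + c *\<^sub>C y"
    by (simp add: scaleC_vec_def vec_eq_iff scaleC_add_right)
  show "(c + d) *\<^sub>C x = c *\<^sub>C x + d *\<^sub>C x"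
    by (simp add: scaleC_vec_def vec_eq_iff scaleC_add_left)
  show "c *\<^sub>C d *\<^sub>C x = (c * d) *\<^sub>C x"
    by (simp add: scaleC_vec_def vec_eq_iff scaleC_scaleC)
  show "complex_of_real r *\<^sub>C x = r *\<^sub>R x"
    by (simp add: scaleC_vec_def vec_eq_iff scaleC_of_real)
  show "cinner x y = cnj (cinner y x)"
    unfolding cinner_vec_def cnj_sum by (rule sum.cong[OF refl]) (rule cinner_commute)
  show "cinner (x + y) z = cinner x z + cinner y z"
    by (simp add: cinner_vec_def cinner_add_left sum.distrib)
  show "cinner (c *\<^sub>C x) y = c * cinner x y"
    by (simp add: cinner_vec_def scaleC_vec_def cinner_scaleC_left sum_distrib_left)
  show "0 \<le> Re (cinner x x)"
    by (simp add: cinner_vec_def cinner_self_nonneg sum_nonneg)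
  show "norm x = sqrt (Re (cinner x x))"
    by (simp add: norm_vec_def L2_set_def cinner_vec_def norm_eq_sqrt_cinner cinner_self_nonneg)
qed

end

definition bounded_clinear :: "('a::chilbert_space \<Rightarrow> 'b::chilbert_space) \<Rightarrow> bool"
  where "bounded_clinear T \<longleftrightarrow> bounded_linear T \<and> (\<forall>c x. T (c *\<^sub>C x) = c *\<^sub>C T x)"

text \<open>The inserted 0 does not affect the supremum of these nonnegative numbers, except that it
  makes the numerical radius 0 on the zero space, where there are no unit vectors.\<close>

definition numerical_radius :: "('a::chilbert_space \<Rightarrow> 'a) \<Rightarrow> real"
  where "numerical_radius T = Sup (insert 0 {cmod (cinner (T x) x) | x. norm x = 1})"

definition cadjoint :: "('a::chilbert_space \<Rightarrow> 'a) \<Rightarrow> 'a \<Rightarrow> 'a"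
  where "cadjoint T = (THE S. \<forall>x y. cinner (T x) y = cinner x (S y))"

definition positive_op :: "('a::chilbert_space \<Rightarrow> 'a) \<Rightarrow> bool"
  where "positive_op T \<longleftrightarrow> bounded_clinear T \<and> (\<forall>x. cinner (T x) x \<in> \<real> \<and> 0 \<le> Re (cinner (T x) x))"

definition sqrt_op :: "('a::chilbert_space \<Rightarrow> 'a) \<Rightarrow> 'a \<Rightarrow> 'a"
  where "sqrt_op T = (THE S. positive_op S \<and> S \<circ> S = T)"

definition abs_op :: "('a::chilbert_space \<Rightarrow> 'a) \<Rightarrow> 'a \<Rightarrow> 'a"
  where "abs_op T = sqrt_op (cadjoint T \<circ> T)"

definition op_spectrum :: "('a::chilbert_space \<Rightarrow> 'a) \<Rightarrow> complex set"
  where "op_spectrum T = {c. \<not> (\<exists>S. bounded_clinear S \<and>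
    (\<forall>x. S (T x - c *\<^sub>C x) = x) \<and> (\<forall>x. T (S x) - c *\<^sub>C S x = x))}"

definition poly_op :: "real poly \<Rightarrow> ('a::chilbert_space \<Rightarrow> 'a) \<Rightarrow> 'a \<Rightarrow> 'a"
  where "poly_op p T x = (\<Sum>i\<le>degree p. coeff p i *\<^sub>R (T ^^ i) x)"

text \<open>The continuous functional calculus of a self-adjoint operator \<open>T\<close> (whose spectrum is real)
  at a real function \<open>f\<close> continuous on the spectrum: \<open>f(T)\<close> is the limit in operator norm of
  \<open>p\<^sub>k(T)\<close>, for any polynomials \<open>p\<^sub>k\<close> converging to \<open>f\<close> uniformly on the spectrum.\<close>

definition cont_fun_calc :: "(real \<Rightarrow> real) \<Rightarrow> ('a::chilbert_space \<Rightarrow> 'a) \<Rightarrow> 'a \<Rightarrow> 'a"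
  where "cont_fun_calc f T = (THE S. bounded_clinear S \<and>
    (\<forall>p. uniform_limit {t. complex_of_real t \<in> op_spectrum T} (\<lambda>k. poly (p k)) f sequentially
      \<longrightarrow> (\<lambda>k. onorm (\<lambda>x. poly_op (p k) T x - S x)) \<longlonglongrightarrow> 0))"

definition block_op :: "('n \<Rightarrow> 'n \<Rightarrow> 'a \<Rightarrow> 'a) \<Rightarrow> 'a::chilbert_space ^ 'n \<Rightarrow> 'a ^ 'n::finite"
  where "block_op A x = (\<chi> i. \<Sum>j\<in>UNIV. A i j (x $ j))"

definition offdiag_coeff ::
    "(real \<Rightarrow> real) \<Rightarrow> (real \<Rightarrow> real) \<Rightarrow> ('n \<Rightarrow> 'n \<Rightarrow> 'a \<Rightarrow> 'a::chilbert_space) \<Rightarrow> 'n \<Rightarrow> 'n \<Rightarrow> real"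
  where "offdiag_coeff f g A i j =
    sqrt (onorm (\<lambda>x. (cont_fun_calc f (abs_op (A i j)) ^^ 2) x
                   + (cont_fun_calc g (abs_op (cadjoint (A j i))) ^^ 2) x)) *
    sqrt (onorm (\<lambda>x. (cont_fun_calc f (abs_op (A j i)) ^^ 2) x
                   + (cont_fun_calc g (abs_op (cadjoint (A i j))) ^^ 2) x))"

end

theory Submission
  imports Defs "HOL-Computational_Algebra.Fundamental_Theorem_Algebra"
begin

text \<open>The core is the mixed Schwarz inequality
  \<open>\<bar>\<langle>A x, y\<rangle>\<bar> \<le> \<parallel>f(|A|) x\<parallel> \<parallel>g(|A\<^sup>*|) y\<parallel>\<close>. Applied to both \<open>A\<^sub>i\<^sub>j\<close> and \<open>A\<^sub>j\<^sub>i\<close>, and combined with the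
  Cauchy-Schwarz inequality in the plane, it bounds the two terms of the quadratic form of the block
  operator at \<open>x\<close> belonging to a pair \<open>i < j\<close> by \<open>a\<^sub>i\<^sub>j \<parallel>x\<^sub>j\<parallel> \<parallel>x\<^sub>i\<parallel>\<close>. Hence the whole form is dominated
  by the form of the triangular matrix at the unit vector \<open>(\<parallel>x\<^sub>i\<parallel>)\<^sub>i\<close>.

  The functional calculus rests on the estimate \<open>\<parallel>p(T)\<parallel> \<le> sup \<bar>p\<bar>\<close> over the spectrum of a self-adjoint
  operator \<open>T\<close>, which follows by factoring \<open>p\<^sup>2 - \<parallel>p(T)\<parallel>\<^sup>2\<close> into linear factors.\<close>

section \<open>Complex Hilbert spaces and adjoints\<close>

text \<open>\<open>cadjoint\<close>, \<open>sqrt_op\<close> and \<open>cont_fun_calc\<close> are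
  definite descriptions, so nothing can be said about them before existence and uniqueness are
  proved. This forces the projection theorem, Riesz representation, the calculus and the uniqueness
  of positive roots to precede every inequality. Spectral points are found through failing lower
  bounds \<open>c * norm x \<le> norm (S x)\<close> rather than failing inverses: lower bounds pass
  through a product of linear factors directly, and for self-adjoint operators they already yield
  invertibility. The shape of \<open>offdiag_coeff\<close> comes from regrouping by vector. At
  \<open>x $ j\<close>, the block \<open>A i j\<close> contributes \<open>f\<close> of its absolute
  value, and \<open>A j i\<close> contributes \<open>g\<close> of the absolute value of its adjoint;
  at \<open>x $ i\<close> the roles are exchanged. Collecting what acts on the same vector produces
  the two sums of squares. At a vector with real coordinates, only the sum of the entries (i,j) and
  (j,i) enters the quadratic form of a matrix, so the joint bound can sit above the diagonal with 0
  below it.\<close>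

lemma cinner_add_right: "cinner x (y + z) = cinner x y + cinner x (z::'a::chilbert_space)"
  by (metis cinner_add_left cinner_commute complex_cnj_add)

lemma cinner_scaleC_right: "cinner x (c *\<^sub>C y) = cnj c * cinner x (y::'a::chilbert_space)"
  by (metis cinner_scaleC_left cinner_commute complex_cnj_mult)

lemma cinner_scaleR_left: "cinner (r *\<^sub>R x) y = r *\<^sub>R cinner x (y::'a::chilbert_space)"
  by (metis cinner_scaleC_left scaleC_of_real scaleR_conv_of_real)

lemma cinner_scaleR_right: "cinner x (r *\<^sub>R y) = r *\<^sub>R cinner x (y::'a::chilbert_space)"
  by (metis cinner_scaleC_right scaleC_of_real scaleR_conv_of_real complex_cnj_complex_of_real)

lemma cinner_minus_left: "cinner (- x) y = - cinner x (y::'a::chilbert_space)"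
  using cinner_scaleR_left[of "-1" x y] by simp

lemma cinner_minus_right: "cinner x (- y) = - cinner x (y::'a::chilbert_space)"
  using cinner_scaleR_right[of x "-1" y] by simp

lemma cinner_diff_left: "cinner (x - y) z = cinner x z - cinner y (z::'a::chilbert_space)"
  using cinner_add_left[of x "-y" z] by (simp add: cinner_minus_left)

lemma cinner_diff_right: "cinner x (y - z) = cinner x y - cinner x (z::'a::chilbert_space)"
  using cinner_add_right[of x y "-z"] by (simp add: cinner_minus_right)

lemma cinner_zero_left [simp]: "cinner 0 y = 0"
  using cinner_scaleR_left[of 0 0 y] by simp

lemma cinner_zero_right [simp]: "cinner y 0 = 0"
  using cinner_scaleR_right[of y 0 0] by simp

lemmas cinner_algebra = cinner_add_left cinner_add_right cinner_diff_left cinner_diff_right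
  cinner_scaleC_left cinner_scaleC_right cinner_scaleR_left cinner_scaleR_right

lemma cinner_self: "cinner x x = of_real ((norm x)\<^sup>2)"
proof -
  have "Im (cinner x x) = 0"
    using arg_cong[OF cinner_commute[of x x], of Im] by simp
  then show ?thesis
    by (simp add: complex_eq_iff norm_eq_sqrt_cinner cinner_self_nonneg)
qed

lemma Re_cinner_commute: "Re (cinner x y) = Re (cinner y x)"
  using arg_cong[OF cinner_commute[of x y], of Re] by simp

lemma norm_add_sq: "(norm (x + y))\<^sup>2 = (norm x)\<^sup>2 + (norm y)\<^sup>2 + 2 * Re (cinner x (y::'a::chilbert_space))"
proof -
  have "cinner (x + y) (x + y) = cinner x x + cinner y y + (cinner x y + cinner y x)"
    by (simp add: cinner_algebra)
  from arg_cong[OF this, of Re] show ?thesis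
    using Re_cinner_commute[of x y] unfolding cinner_self by (simp del: of_real_power)
qed

lemma norm_diff_sq: "(norm (x - y))\<^sup>2 = (norm x)\<^sup>2 + (norm y)\<^sup>2 - 2 * Re (cinner x (y::'a::chilbert_space))"
  using norm_add_sq[of x "-y"] by (simp add: cinner_minus_right)

lemma norm_scaleC: "norm (c *\<^sub>C x) = cmod c * norm (x::'a::chilbert_space)"
proof -
  have "complex_of_real ((norm (c *\<^sub>C x))\<^sup>2) = (c * cnj c) * of_real ((norm x)\<^sup>2)"
    unfolding cinner_self[symmetric] by (simp add: cinner_algebra)
  then have "complex_of_real ((norm (c *\<^sub>C x))\<^sup>2) = of_real ((cmod c * norm x)\<^sup>2)"
    by (simp add: complex_mult_cnj cmod_power2 power_mult_distrib)
  then have "(norm (c *\<^sub>C x))\<^sup>2 = (cmod c * norm x)\<^sup>2"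
    using of_real_eq_iff by blast
  then show ?thesis by (simp add: power2_eq_iff_nonneg)
qed

text \<open>Pythagoras after removing the component of \<open>z\<close> along \<open>y\<close>.
  Nonnegativity of the left side gives Cauchy-Schwarz; minimality of a distance gives
  orthogonality.\<close>

lemma norm_diff_component_sq:
  fixes z y :: "'a::chilbert_space"
  assumes "y \<noteq> 0"
  shows "(norm (z - (cinner z y / of_real ((norm y)\<^sup>2)) *\<^sub>C y))\<^sup>2
    = (norm z)\<^sup>2 - (cmod (cinner z y))\<^sup>2 / (norm y)\<^sup>2"
proof -
  let ?w = "cinner z y"
  let ?n = "(norm y)\<^sup>2"
  have "cnj (?w / of_real ?n) * ?w = of_real ((cmod ?w)\<^sup>2) / of_real ?n"
    unfolding complex_norm_square by (simp add: mult.commute)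
  then have a: "Re (cnj (?w / of_real ?n) * ?w) = (cmod ?w)\<^sup>2 / ?n"
    by (simp only: of_real_divide[symmetric] Re_complex_of_real)
  have b: "(cmod (?w / of_real ?n) * norm y)\<^sup>2 = (cmod ?w)\<^sup>2 / ?n"
    using assms by (simp add: norm_divide norm_power power_divide power_mult_distrib field_simps)
  show ?thesis
    unfolding norm_diff_sq norm_scaleC b cinner_scaleC_right a by simp
qed

lemma cinner_Cauchy_Schwarz: "cmod (cinner x y) \<le> norm x * norm (y::'a::chilbert_space)"
proof (cases "y = 0")
  case False
  have "0 \<le> (norm x)\<^sup>2 - (cmod (cinner x y))\<^sup>2 / (norm y)\<^sup>2"
    unfolding norm_diff_component_sq[OF False, symmetric] by simp
  then have "(cmod (cinner x y))\<^sup>2 \<le> (norm x * norm y)\<^sup>2"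
    using False by (simp add: field_simps power_mult_distrib)
  then show ?thesis by (rule power2_le_imp_le) simp
qed simp

lemma bounded_bilinear_cinner: "bounded_bilinear (cinner :: 'a::chilbert_space \<Rightarrow> 'a \<Rightarrow> complex)"
  by standard (auto simp: cinner_algebra intro!: exI[of _ 1] cinner_Cauchy_Schwarz)

lemmas tendsto_cinner = bounded_bilinear.tendsto[OF bounded_bilinear_cinner]

lemma cinner_eqI:
  fixes x y :: "'a::chilbert_space"
  assumes "\<And>z. cinner x z = cinner y z"
  shows "x = y"
proof -
  have "cinner (x - y) (x - y) = 0"
    using assms[of "x - y"] unfolding cinner_diff_left by simp
  then show ?thesis by (simp add: cinner_self)
qed

section \<open>Bounded complex-linear maps\<close>

lemma bounded_clinear_scaleC: "bounded_clinear T \<Longrightarrow> T (c *\<^sub>C x) = c *\<^sub>C T x"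
  by (simp add: bounded_clinear_def)

lemma bounded_clinear_add: "bounded_clinear T \<Longrightarrow> T (x + y) = T x + T y"
  by (simp add: bounded_clinear_def bounded_linear.linear linear_add)

lemma bounded_clinear_diff: "bounded_clinear T \<Longrightarrow> T (x - y) = T x - T y"
  by (simp add: bounded_clinear_def bounded_linear.linear linear_diff)

lemma bounded_clinear_scaleR: "bounded_clinear T \<Longrightarrow> T (r *\<^sub>R x) = r *\<^sub>R T x"
  by (simp add: bounded_clinear_def bounded_linear.linear linear_cmul)

lemma bounded_clinear_zero: "bounded_clinear T \<Longrightarrow> T 0 = 0"
  by (simp add: bounded_clinear_def bounded_linear.linear linear_0)

lemma bounded_clinear_bound: "bounded_clinear T \<Longrightarrow> norm (T x) \<le> onorm T * norm x"
  by (simp add: bounded_clinear_def onorm)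

lemma bounded_clinear_onorm_pos: "bounded_clinear T \<Longrightarrow> 0 \<le> onorm T"
  by (simp add: bounded_clinear_def onorm_pos_le)

lemma bounded_clinear_tendsto: "bounded_clinear T \<Longrightarrow> (X \<longlongrightarrow> x) F \<Longrightarrow> ((\<lambda>k. T (X k)) \<longlongrightarrow> T x) F"
  by (simp add: bounded_clinear_def bounded_linear.tendsto)

lemma bounded_clinearI:
  fixes T :: "'a::chilbert_space \<Rightarrow> 'b::chilbert_space"
  assumes "\<And>x y. T (x + y) = T x + T y" and "\<And>c x. T (c *\<^sub>C x) = c *\<^sub>C T x"
    and "\<And>x. norm (T x) \<le> norm x * K"
  shows "bounded_clinear T"
  unfolding bounded_clinear_def
  using assms(2)[of "complex_of_real _"]
  by (auto simp: scaleC_of_real assms intro!: bounded_linear_intro[of T K])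

lemma scaleC_zero_one [simp]: "(0::complex) *\<^sub>C x = 0" "(1::complex) *\<^sub>C x = x"
  using scaleC_of_real[of 0 x] scaleC_of_real[of 1 x] by auto

lemma scaleC_zero_right [simp]: "c *\<^sub>C 0 = (0::'a::chilbert_space)"
  by (metis norm_scaleC mult_zero_right norm_eq_zero)

lemma scaleC_minus: "c *\<^sub>C (- x) = - (c *\<^sub>C (x::'a::chilbert_space))"
  by (metis add.right_inverse add_eq_0_iff scaleC_add_right scaleC_zero_right)

lemma scaleC_diff: "c *\<^sub>C (x - y) = c *\<^sub>C x - c *\<^sub>C (y::'a::chilbert_space)"
  using scaleC_add_right[of c x "- y"] by (simp add: scaleC_minus)

lemma bounded_clinear_ident: "bounded_clinear (\<lambda>x. x)"
  by (simp add: bounded_clinear_def)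

lemma bounded_clinear_comp: "bounded_clinear S \<Longrightarrow> bounded_clinear T \<Longrightarrow> bounded_clinear (\<lambda>x. S (T x))"
  by (simp add: bounded_clinear_def bounded_linear_compose)

lemma bounded_clinear_plus: "bounded_clinear S \<Longrightarrow> bounded_clinear T \<Longrightarrow> bounded_clinear (\<lambda>x. S x + T x)"
  by (simp add: bounded_clinear_def bounded_linear_add scaleC_add_right)

lemma bounded_clinear_minus: "bounded_clinear S \<Longrightarrow> bounded_clinear T \<Longrightarrow> bounded_clinear (\<lambda>x. S x - T x)"
  by (simp add: bounded_clinear_def bounded_linear_sub scaleC_diff)

lemma bounded_clinear_scale:
  assumes "bounded_clinear S"
  shows "bounded_clinear (\<lambda>x. c *\<^sub>C S x)"
proof (rule bounded_clinearI[where K = "cmod c * onorm S"])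
  fix x
  have "cmod c * norm (S x) \<le> cmod c * (onorm S * norm x)"
    by (intro mult_left_mono bounded_clinear_bound assms) simp
  then show "norm (c *\<^sub>C S x) \<le> norm x * (cmod c * onorm S)"
    by (simp add: norm_scaleC ac_simps)
qed (simp_all add: bounded_clinear_add bounded_clinear_scaleC scaleC_add_right scaleC_scaleC
    mult.commute assms)

lemma bounded_clinear_scaleR': "bounded_clinear S \<Longrightarrow> bounded_clinear (\<lambda>x. r *\<^sub>R S x)"
  using bounded_clinear_scale[of S "of_real r"] by (simp add: scaleC_of_real)

section \<open>Orthogonal projection, Riesz representation and the adjoint\<close>

lemma parallelogram_midpoint:
  fixes x m n :: "'a::chilbert_space"
  shows "(norm (m - n))\<^sup>2 = 2 * (norm (x - m))\<^sup>2 + 2 * (norm (x - n))\<^sup>2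
    - 4 * (norm (x - (1/2) *\<^sub>R (m + n)))\<^sup>2"
proof -
  have "4 * (norm (x - (1/2) *\<^sub>R (m + n)))\<^sup>2 = (norm (2 *\<^sub>R (x - (1/2) *\<^sub>R (m + n))))\<^sup>2"
    by (simp only: norm_scaleR power_mult_distrib) simp
  also have "2 *\<^sub>R (x - (1/2) *\<^sub>R (m + n)) = (x - m) + (x - n)"
    by (simp add: scaleR_2 algebra_simps)
  finally have a: "4 * (norm (x - (1/2) *\<^sub>R (m + n)))\<^sup>2 = (norm ((x - m) + (x - n)))\<^sup>2" .
  have b: "m - n = (x - n) - (x - m)" by simp
  show ?thesis unfolding a unfolding b norm_add_sq norm_diff_sq[of "x - n" "x - m"]
    using Re_cinner_commute[of "x - n" "x - m"] by simp
qed

text \<open>A sequence minimizing the distance to \<open>M\<close> is Cauchy, and its limit is the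
  foot of the perpendicular: any component of \<open>x - m\<close> along some \<open>y\<close> in
  \<open>M\<close> could be removed to come closer.\<close>

lemma orthogonal_projection_exists:
  fixes M :: "'a::chilbert_space set"
  assumes "closed M" "0 \<in> M" and add: "\<And>x y. x \<in> M \<Longrightarrow> y \<in> M \<Longrightarrow> x + y \<in> M"
    and scale: "\<And>c x. x \<in> M \<Longrightarrow> c *\<^sub>C x \<in> M"
  obtains m where "m \<in> M" "\<And>y. y \<in> M \<Longrightarrow> cinner (x - m) y = 0"
proof -
  define D where "D = (INF m\<in>M. (norm (x - m))\<^sup>2)"
  have bdd: "bdd_below ((\<lambda>m. (norm (x - m))\<^sup>2) ` M)"
    by (rule bdd_belowI[of _ 0]) auto
  have D_le: "D \<le> (norm (x - m))\<^sup>2" if "m \<in> M" for m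
    unfolding D_def by (rule cINF_lower[OF bdd that])
  have "\<exists>m\<in>M. (norm (x - m))\<^sup>2 < D + 1 / real (Suc k)" for k
  proof -
    have "D < D + 1 / real (Suc k)" by simp
    then show ?thesis
      unfolding D_def using cINF_less_iff[OF _ bdd] \<open>0 \<in> M\<close> by blast
  qed
  then obtain s where s: "\<And>k. s k \<in> M" "\<And>k. (norm (x - s k))\<^sup>2 < D + 1 / real (Suc k)"
    by metis
  \<comment> \<open>The midpoint of \<open>s k\<close> and \<open>s l\<close> lies in
    \<open>M\<close>, so its squared distance to \<open>x\<close> is at least \<open>D\<close>; the
    parallelogram identity then leaves only the two excesses over \<open>D\<close>.\<close>
  have close: "(norm (s k - s l))\<^sup>2 \<le> 2 / real (Suc k) + 2 / real (Suc l)" for k l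
  proof -
    have "(1/2) *\<^sub>R (s k + s l) \<in> M"
      using scale[OF add[OF s(1) s(1)], of "of_real (1/2)"] by (simp only: scaleC_of_real)
    from D_le[OF this] have "4 * D \<le> 4 * (norm (x - (1/2) *\<^sub>R (s k + s l)))\<^sup>2" by simp
    then show ?thesis
      unfolding parallelogram_midpoint[of "s k" "s l" x] using s(2)[of k] s(2)[of l]
      by linarith
  qed
  have "Cauchy s"
  proof (rule metric_CauchyI)
    fix e :: real assume "e > 0"
    \<comment> \<open>For indices beyond \<open>N\<close>, the bound in \<open>close\<close> is at
      most four times \<open>1 / real (Suc N)\<close>, hence the quarter.\<close>
    obtain N where N: "1 / real (Suc N) < e\<^sup>2 / 4"
      using \<open>e > 0\<close> nat_approx_posE[of "e\<^sup>2 / 4"] by (metis divide_pos_pos zero_less_numeral zero_less_power)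
    have "dist (s k) (s l) < e" if "k \<ge> N" "l \<ge> N" for k l
    proof -
      have "1 / real (Suc k) \<le> 1 / real (Suc N)" "1 / real (Suc l) \<le> 1 / real (Suc N)"
        using that by (auto intro!: divide_left_mono)
      then have "(norm (s k - s l))\<^sup>2 < e\<^sup>2"
        using close[of k l] N by simp
      then show ?thesis
        using \<open>e > 0\<close> by (simp add: dist_norm power2_less_imp_less)
    qed
    then show "\<exists>N. \<forall>k\<ge>N. \<forall>l\<ge>N. dist (s k) (s l) < e" by blast
  qed
  then obtain m where lim: "s \<longlonglongrightarrow> m"
    using Cauchy_convergent convergent_def by blast
  have "m \<in> M"
    using closed_sequentially[OF \<open>closed M\<close> _ lim] s(1) by blast
  have "(norm (x - m))\<^sup>2 \<le> D + 0"
  proof (rule LIMSEQ_le)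
    show "(\<lambda>k. (norm (x - s k))\<^sup>2) \<longlonglongrightarrow> (norm (x - m))\<^sup>2"
      by (intro tendsto_intros lim)
    show "(\<lambda>k. D + 1 / real (Suc k)) \<longlonglongrightarrow> D + 0"
      by (intro tendsto_add tendsto_const lim_1_over_n[THEN LIMSEQ_Suc])
    show "\<exists>N. \<forall>k\<ge>N. (norm (x - s k))\<^sup>2 \<le> D + 1 / real (Suc k)"
      using s(2) less_imp_le by blast
  qed
  then have min: "(norm (x - m))\<^sup>2 \<le> (norm (x - m'))\<^sup>2" if "m' \<in> M" for m'
    using D_le[OF that] by linarith
  have "cinner (x - m) y = 0" if "y \<in> M" for y
  proof (cases "y = 0")
    case False
    \<comment> \<open>The multiple of \<open>y\<close> whose removal shortens \<open>x - m\<close>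
      the most.\<close>
    let ?c = "cinner (x - m) y / of_real ((norm y)\<^sup>2)"
    have "(norm (x - m))\<^sup>2 \<le> (norm (x - (m + ?c *\<^sub>C y)))\<^sup>2"
      by (rule min) (intro add scale \<open>m \<in> M\<close> that)
    also have "x - (m + ?c *\<^sub>C y) = x - m - ?c *\<^sub>C y" by simp
    finally have "(cmod (cinner (x - m) y))\<^sup>2 / (norm y)\<^sup>2 \<le> 0"
      unfolding norm_diff_component_sq[OF False] by simp
    then show ?thesis
      using False by (simp add: divide_le_0_iff)
  qed simp
  with \<open>m \<in> M\<close> show ?thesis by (rule that)
qed

text \<open>The kernel of a nonzero functional is closed of codimension one, so a vector orthogonal
  to it represents the functional after rescaling.\<close>

lemma Riesz_representation:
  fixes \<phi> :: "'a::chilbert_space \<Rightarrow> complex"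
  assumes "bounded_clinear \<phi>"
  obtains z where "\<And>x. \<phi> x = cinner x z"
proof (cases "\<forall>x. \<phi> x = 0")
  case True
  then show ?thesis using that[of 0] by simp
next
  case False
  then obtain x where x: "\<phi> x \<noteq> 0" by blast
  let ?M = "{x. \<phi> x = 0}"
  have "continuous_on UNIV \<phi>"
    using assms by (simp add: bounded_clinear_def linear_continuous_on)
  then have "closed ?M"
    by (intro closed_Collect_eq continuous_intros) auto
  then obtain m where m: "\<phi> m = 0" "\<And>y. \<phi> y = 0 \<Longrightarrow> cinner (x - m) y = 0"
    using orthogonal_projection_exists[of ?M x] assms
    by (auto simp: bounded_clinear_add bounded_clinear_scaleC bounded_clinear_zero scaleC_complex_def)
  let ?z = "x - m"
  have z: "\<phi> ?z \<noteq> 0"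
    using x m(1) by (simp add: bounded_clinear_diff[OF assms])
  then have "?z \<noteq> 0"
    using bounded_clinear_zero[OF assms] by metis
  have "\<phi> v = cinner v (cnj (\<phi> ?z / of_real ((norm ?z)\<^sup>2)) *\<^sub>C ?z)" for v
  proof -
    \<comment> \<open>Subtracting the right multiple of \<open>?z\<close> moves any \<open>v\<close>
      into the kernel, to which \<open>?z\<close> is orthogonal.\<close>
    have "\<phi> (v - (\<phi> v / \<phi> ?z) *\<^sub>C ?z) = 0"
      using z bounded_clinear_diff[OF assms] bounded_clinear_scaleC[OF assms]
      by (simp add: scaleC_complex_def)
    then have "cinner ?z (v - (\<phi> v / \<phi> ?z) *\<^sub>C ?z) = 0" by (rule m)
    then have "cinner (v - (\<phi> v / \<phi> ?z) *\<^sub>C ?z) ?z = 0"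
      by (metis cinner_commute complex_cnj_zero)
    then have "cinner v ?z = (\<phi> v / \<phi> ?z) * of_real ((norm ?z)\<^sup>2)"
      by (simp only: cinner_diff_left cinner_scaleC_left cinner_self) simp
    then show ?thesis
      using z \<open>?z \<noteq> 0\<close> by (simp add: cinner_scaleC_right)
  qed
  then show ?thesis by (rule that)
qed

text \<open>Existence is Riesz representation of the functional in \<open>x\<close>, separately for
  each \<open>y\<close>; uniqueness holds because inner products separate vectors.\<close>

lemma cadjoint_ex1:
  assumes "bounded_clinear T"
  shows "\<exists>!S. \<forall>x y. cinner (T x) y = cinner x (S y)"
proof (rule ex_ex1I)
  have "\<exists>z. \<forall>x. cinner (T x) y = cinner x z" for y
  proof -
    have "bounded_clinear (\<lambda>x. cinner (T x) y)"
    proof (rule bounded_clinearI[where K = "onorm T * norm y"])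
      fix x
      have "cmod (cinner (T x) y) \<le> norm (T x) * norm y" by (rule cinner_Cauchy_Schwarz)
      also have "\<dots> \<le> onorm T * norm x * norm y"
        by (intro mult_right_mono bounded_clinear_bound assms) simp
      finally show "cmod (cinner (T x) y) \<le> norm x * (onorm T * norm y)" by (simp add: ac_simps)
    qed (simp_all add: bounded_clinear_add bounded_clinear_scaleC assms cinner_algebra scaleC_complex_def)
    from Riesz_representation[OF this] show ?thesis by metis
  qed
  then show "\<exists>S. \<forall>x y. cinner (T x) y = cinner x (S y)" by metis
next
  fix S S'
  assume "\<forall>x y. cinner (T x) y = cinner x (S y)" "\<forall>x y. cinner (T x) y = cinner x (S' y)"
  then show "S = S'"
    by (metis cinner_commute cinner_eqI ext)
qed

lemma cadjoint: "bounded_clinear T \<Longrightarrow> cinner (T x) y = cinner x (cadjoint T y)"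
  using theI'[OF cadjoint_ex1] unfolding cadjoint_def by blast

lemma cadjoint': "bounded_clinear T \<Longrightarrow> cinner (cadjoint T x) y = cinner x (T y)"
  by (metis cadjoint cinner_commute)

lemma cadjoint_eqI: "bounded_clinear T \<Longrightarrow> (\<And>x y. cinner (T x) y = cinner x (S y)) \<Longrightarrow> cadjoint T = S"
  unfolding cadjoint_def by (rule the1_equality[OF cadjoint_ex1]) auto

lemma bounded_clinear_cadjoint:
  assumes "bounded_clinear T"
  shows "bounded_clinear (cadjoint T)"
proof (rule bounded_clinearI[where K = "onorm T"])
  fix x y c
  show "cadjoint T (x + y) = cadjoint T x + cadjoint T y"
    by (rule cinner_eqI) (simp add: cadjoint'[OF assms] cinner_algebra)
  show "cadjoint T (c *\<^sub>C x) = c *\<^sub>C cadjoint T x"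
    by (rule cinner_eqI) (simp add: cadjoint'[OF assms] cinner_algebra)
  let ?y = "cadjoint T x"
  have "(norm ?y)\<^sup>2 = cmod (cinner ?y ?y)"
    by (simp add: cinner_self norm_power)
  also have "\<dots> = cmod (cinner x (T ?y))"
    by (simp add: cadjoint'[OF assms])
  also have "\<dots> \<le> norm x * norm (T ?y)" by (rule cinner_Cauchy_Schwarz)
  also have "\<dots> \<le> norm x * (onorm T * norm ?y)"
    by (intro mult_left_mono bounded_clinear_bound assms) simp
  finally have "norm ?y * norm ?y \<le> (norm x * onorm T) * norm ?y"
    by (simp add: power2_eq_square ac_simps)
  \<comment> \<open>Boundedness of \<open>T\<close> bounds the square of \<open>norm ?y\<close> by a
    multiple of \<open>norm ?y\<close>; one factor is cancelled unless it is 0.\<close>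
  then show "norm ?y \<le> norm x * onorm T"
    using bounded_clinear_onorm_pos[OF assms] by (cases "norm ?y = 0") auto
qed

lemma cadjoint_cadjoint: "bounded_clinear T \<Longrightarrow> cadjoint (cadjoint T) = T"
  by (simp add: cadjoint_eqI bounded_clinear_cadjoint cadjoint')

section \<open>Polynomials of self-adjoint operators and the spectrum\<close>

lemma poly_op_altdef:
  assumes "degree p \<le> n"
  shows "poly_op p T x = (\<Sum>i\<le>n. coeff p i *\<^sub>R (T ^^ i) x)"
  unfolding poly_op_def
  by (rule sum.mono_neutral_left) (use assms in \<open>auto simp: coeff_eq_0\<close>)

lemma poly_op_0 [simp]: "poly_op 0 T x = 0"
  by (simp add: poly_op_def)

lemma poly_op_add: "poly_op (p + q) T x = poly_op p T x + poly_op q T x"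
proof -
  let ?n = "max (degree p) (degree q)"
  have "degree (p + q) \<le> ?n" "degree p \<le> ?n" "degree q \<le> ?n"
    by (auto simp: degree_add_le)
  then show ?thesis
    by (simp add: poly_op_altdef[where n = ?n] scaleR_left_distrib sum.distrib)
qed

lemma poly_op_smult: "poly_op (smult a p) T x = a *\<^sub>R poly_op p T x"
proof -
  have "degree (smult a p) \<le> degree p" by (rule degree_smult_le)
  then show ?thesis
    by (simp add: poly_op_altdef[where n = "degree p"] scaleR_sum_right)
qed

lemma poly_op_diff: "poly_op (p - q) T x = poly_op p T x - poly_op q T x"
  using poly_op_add[of "p - q" q T x] by simp

lemma poly_op_pCons:
  assumes "bounded_clinear T"
  shows "poly_op (pCons a p) T x = a *\<^sub>R x + T (poly_op p T x)"
proof -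
  have "poly_op (pCons a p) T x = (\<Sum>i\<le>Suc (degree p). coeff (pCons a p) i *\<^sub>R (T ^^ i) x)"
    by (rule poly_op_altdef) (rule degree_pCons_le)
  also have "\<dots> = a *\<^sub>R x + (\<Sum>i\<le>degree p. coeff p i *\<^sub>R T ((T ^^ i) x))"
    by (subst sum.atMost_Suc_shift) simp
  also have "(\<Sum>i\<le>degree p. coeff p i *\<^sub>R T ((T ^^ i) x)) = T (poly_op p T x)"
    using assms by (simp add: poly_op_def bounded_clinear_def bounded_linear.linear linear_sum linear_cmul)
  finally show ?thesis .
qed

lemma poly_op_const: "poly_op [:a:] T x = a *\<^sub>R x"
  by (simp add: poly_op_def)

lemma poly_op_ident: "bounded_clinear T \<Longrightarrow> poly_op [:0, 1:] T x = T x"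
  by (simp add: poly_op_pCons poly_op_const)

lemma bounded_clinear_poly_op:
  assumes "bounded_clinear T"
  shows "bounded_clinear (poly_op p T)"
proof (induction p)
  case 0
  show ?case by (rule bounded_clinearI[where K = 0]) simp_all
next
  case (pCons a p)
  have "bounded_clinear (\<lambda>x. a *\<^sub>R x + T (poly_op p T x))"
    by (intro bounded_clinear_plus bounded_clinear_scaleR' bounded_clinear_ident
        bounded_clinear_comp[OF assms] pCons)
  also have "(\<lambda>x. a *\<^sub>R x + T (poly_op p T x)) = poly_op (pCons a p) T"
    by (simp add: fun_eq_iff poly_op_pCons[OF assms])
  finally show ?case .
qed

lemma poly_op_mult:
  assumes "bounded_clinear T"
  shows "poly_op (p * q) T x = poly_op p T (poly_op q T x)"
proof (induction p)
  case (pCons a p)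
  have "poly_op (pCons a p * q) T x = poly_op (smult a q + pCons 0 (p * q)) T x" by simp
  also have "\<dots> = a *\<^sub>R poly_op q T x + T (poly_op (p * q) T x)"
    unfolding poly_op_add poly_op_smult poly_op_pCons[OF assms] by simp
  finally show ?case using pCons by (simp add: poly_op_pCons[OF assms])
qed simp

text \<open>Prepared for the uniqueness of positive square roots, where polynomials in an operator
  are compared with polynomials in its square.\<close>

lemma poly_op_pcompose_square:
  assumes "bounded_clinear T"
  shows "poly_op (pcompose p [:0, 0, 1:]) T x = poly_op p (\<lambda>x. T (T x)) x"
proof (induction p)
  case (pCons a p)
  have "poly_op [:0, 0, 1:] T y = T (T y)" for y
    by (simp add: poly_op_pCons[OF assms] poly_op_const bounded_clinear_zero[OF assms])
  then show ?case
    by (simp only: pcompose_pCons poly_op_add poly_op_const poly_op_mult[OF assms] pCons.IH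
        poly_op_pCons[OF bounded_clinear_comp[OF assms assms]])
qed simp

text \<open>With \<open>X = T\<close> this is commutation of \<open>T\<close> with its polynomials;
  in general it transports the calculus from one operator to another.\<close>

lemma poly_op_intertwine:
  assumes "bounded_clinear S" "bounded_clinear T" "bounded_clinear X" "\<And>x. X (S x) = T (X x)"
  shows "X (poly_op p S x) = poly_op p T (X x)"
  by (induction p) (simp_all add: poly_op_pCons bounded_clinear_zero bounded_clinear_add
      bounded_clinear_scaleR assms)

section \<open>Self-adjoint and positive operators\<close>

definition self_adjoint :: "('a::chilbert_space \<Rightarrow> 'a) \<Rightarrow> bool"
  where "self_adjoint T \<longleftrightarrow> bounded_clinear T \<and> (\<forall>x y. cinner (T x) y = cinner x (T y))"

lemma self_adjoint_bounded_clinear: "self_adjoint T \<Longrightarrow> bounded_clinear T"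
  by (simp add: self_adjoint_def)

lemma self_adjoint_cinner: "self_adjoint T \<Longrightarrow> cinner (T x) y = cinner x (T y)"
  by (simp add: self_adjoint_def)

lemma self_adjoint_poly_op:
  assumes "self_adjoint T"
  shows "self_adjoint (poly_op p T)"
  unfolding self_adjoint_def
proof (intro conjI allI)
  have T: "bounded_clinear T" using assms by (rule self_adjoint_bounded_clinear)
  show "bounded_clinear (poly_op p T)" by (rule bounded_clinear_poly_op[OF T])
  show "cinner (poly_op p T x) y = cinner x (poly_op p T y)" for x y
  proof (induction p arbitrary: x y)
    case (pCons a p)
    have "T (poly_op p T y) = poly_op p T (T y)"
      by (rule poly_op_intertwine) (auto intro: T)
    then show ?case
      by (simp add: poly_op_pCons[OF T] cinner_algebra pCons self_adjoint_cinner[OF assms])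
  qed simp
qed

lemma self_adjoint_cinner_Im: "self_adjoint T \<Longrightarrow> Im (cinner (T x) x) = 0"
proof -
  assume "self_adjoint T"
  then have "cinner (T x) x = cnj (cinner (T x) x)"
    by (metis self_adjoint_cinner cinner_commute)
  then show ?thesis
    by (simp add: complex_eq_iff)
qed

lemma positive_op_bounded_clinear: "positive_op T \<Longrightarrow> bounded_clinear T"
  by (simp add: positive_op_def)

lemma positive_op_nonneg: "positive_op T \<Longrightarrow> 0 \<le> Re (cinner (T x) x)"
  by (simp add: positive_op_def)

text \<open>Polarization: the sesquilinear form \<open>\<langle>T x, y\<rangle> - \<langle>x, T y\<rangle>\<close> vanishes on the diagonal, so it vanishes.\<close>

lemma positive_op_self_adjoint:
  assumes "positive_op T"
  shows "self_adjoint T"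
  unfolding self_adjoint_def
proof (intro conjI allI)
  show T: "bounded_clinear T" using assms by (rule positive_op_bounded_clinear)
  fix x y
  define B where "B u v = cinner (T u) v - cinner u (T v)" for u v
  have diag: "B u u = 0" for u
  proof -
    have "cinner (T u) u \<in> \<real>" using assms by (simp add: positive_op_def)
    then have "cnj (cinner (T u) u) = cinner (T u) u" by (simp add: Reals_cnj_iff)
    then show ?thesis unfolding B_def by (metis cinner_commute diff_self)
  qed
  have "B (x + y) (x + y) = B x x + B y y + B x y + B y x"
    unfolding B_def by (simp add: bounded_clinear_add[OF T] cinner_algebra)
  \<comment> \<open>The second slot conjugates the scalar, so the cross terms now appear with
    opposite signs and can be separated from the first expansion.\<close>
  moreover have "B (x + \<i> *\<^sub>C y) (x + \<i> *\<^sub>C y) = B x x + B y y - \<i> * B x y + \<i> * B y x"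
    unfolding B_def
    by (simp add: bounded_clinear_add[OF T] bounded_clinear_scaleC[OF T] cinner_algebra algebra_simps)
  ultimately have "B x y + B y x = 0" "\<i> * (B y x - B x y) = 0"
    by (simp_all add: diag algebra_simps)
  then have "B x y = 0" by (simp add: add_eq_0_iff)
  then show "cinner (T x) y = cinner x (T y)"
    by (simp add: B_def)
qed

section \<open>Complex factorization, lower bounds and the spectrum\<close>

text \<open>Complex coefficients are required because roots of real polynomials may be complex. The
  Horner form makes recursion over \<open>pCons\<close> immediate.\<close>

definition cpoly_op :: "complex poly \<Rightarrow> ('a::chilbert_space \<Rightarrow> 'a) \<Rightarrow> 'a \<Rightarrow> 'a"
  where "cpoly_op p T x = fold_coeffs (\<lambda>a y. a *\<^sub>C x + T y) p 0"

lemma cpoly_op_0 [simp]: "cpoly_op 0 T x = 0"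
  by (simp add: cpoly_op_def)

lemma cpoly_op_pCons:
  assumes "bounded_clinear T"
  shows "cpoly_op (pCons a p) T x = a *\<^sub>C x + T (cpoly_op p T x)"
  by (cases "a = 0"; cases "p = 0") (simp_all add: cpoly_op_def bounded_clinear_zero[OF assms])

lemma cpoly_op_add:
  assumes "bounded_clinear T"
  shows "cpoly_op (p + q) T x = cpoly_op p T x + cpoly_op q T x"
  by (induction p q rule: poly_induct2)
    (simp_all add: cpoly_op_pCons bounded_clinear_add scaleC_add_left assms)

lemma cpoly_op_smult:
  assumes "bounded_clinear T"
  shows "cpoly_op (smult a p) T x = a *\<^sub>C cpoly_op p T x"
  by (induction p)
    (simp_all add: cpoly_op_pCons bounded_clinear_scaleC scaleC_scaleC scaleC_add_right assms)

lemma cpoly_op_of_real: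
  assumes "bounded_clinear T"
  shows "cpoly_op (map_poly of_real p) T x = poly_op p T x"
  by (induction p) (simp_all add: map_poly_pCons cpoly_op_pCons poly_op_pCons assms scaleC_of_real)

lemma poly_map_of_real: "poly (map_poly of_real p) (complex_of_real t) = of_real (poly p t)"
  by (induction p) (simp_all add: map_poly_pCons)

text \<open>Quantitative injectivity: a half of invertibility that composes without constructing
  inverses.\<close>

definition bounded_below_op :: "('a::chilbert_space \<Rightarrow> 'a) \<Rightarrow> bool"
  where "bounded_below_op S \<longleftrightarrow> (\<exists>c>0. \<forall>x. c * norm x \<le> norm (S x))"

lemma bounded_below_op_comp:
  assumes "bounded_below_op S" "bounded_below_op T"
  shows "bounded_below_op (\<lambda>x. S (T x))"
proof -
  obtain c d where c: "c > 0" "\<And>x. c * norm x \<le> norm (S x)" and d: "d > 0" "\<And>x. d * norm x \<le> norm (T x)"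
    using assms unfolding bounded_below_op_def by blast
  have "c * d * norm x \<le> norm (S (T x))" for x
  proof -
    have "c * (d * norm x) \<le> c * norm (T x)"
      using c(1) d(2) by (simp add: mult_left_mono)
    also have "\<dots> \<le> norm (S (T x))" by (rule c)
    finally show ?thesis by (simp add: ac_simps)
  qed
  then show ?thesis
    unfolding bounded_below_op_def using c(1) d(1) by (intro exI[of _ "c * d"]) auto
qed

text \<open>The fundamental theorem of algebra splits off linear factors one at a time, and lower
  bounds compose. Read contrapositively, it is the needed half of spectral mapping: a failing lower
  bound for \<open>p\<close> of \<open>T\<close> is caused by a root of \<open>p\<close>.\<close>

lemma bounded_below_cpoly_op:
  assumes T: "bounded_clinear T" and "p \<noteq> 0"
    and "\<And>\<mu>. poly p \<mu> = 0 \<Longrightarrow> bounded_below_op (\<lambda>x. T x - \<mu> *\<^sub>C x)"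
  shows "bounded_below_op (cpoly_op p T)"
  using assms(2,3)
proof (induction "degree p" arbitrary: p rule: less_induct)
  case less
  show ?case
  proof (cases "degree p = 0")
    case True
    then obtain a where "p = [:a:]" by (rule degree_eq_zeroE)
    then show ?thesis
      using less.prems(1)
      by (auto simp: bounded_below_op_def cpoly_op_pCons[OF T] bounded_clinear_zero[OF T] norm_scaleC
          intro!: exI[of _ "cmod a"])
  next
    case False
    then obtain \<mu> where \<mu>: "poly p \<mu> = 0"
      using fundamental_theorem_of_algebra[of p] by (auto simp: constant_degree)
    then obtain q where q: "p = [:- \<mu>, 1:] * q"
      by (auto simp: poly_eq_0_iff_dvd)
    with less.prems(1) have "q \<noteq> 0" by auto
    have "degree p = Suc (degree q)"
      unfolding q using \<open>q \<noteq> 0\<close> by (subst degree_mult_eq) auto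
    then have "bounded_below_op (cpoly_op q T)"
      using \<open>q \<noteq> 0\<close> less.prems(2) q by (intro less.hyps) auto
    then have "bounded_below_op (\<lambda>x. T (cpoly_op q T x) - \<mu> *\<^sub>C cpoly_op q T x)"
      using bounded_below_op_comp[OF less.prems(2)[OF \<mu>]] by simp
    moreover have "cpoly_op p T x = T (cpoly_op q T x) - \<mu> *\<^sub>C cpoly_op q T x" for x
    proof -
      have p: "p = smult (- \<mu>) q + pCons 0 q" by (simp add: q)
      have m: "(- \<mu>) *\<^sub>C y = - (\<mu> *\<^sub>C y)" for y :: 'a
        using scaleC_scaleC[of \<mu> "-1" y] scaleC_of_real[of "-1" y] by (simp add: scaleC_minus)
      show ?thesis
        unfolding p cpoly_op_add[OF T] cpoly_op_smult[OF T] cpoly_op_pCons[OF T] m by simp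
    qed
    ultimately show ?thesis by (simp add: bounded_below_op_def)
  qed
qed

lemma bounded_clinear_shift: "bounded_clinear T \<Longrightarrow> bounded_clinear (\<lambda>x. T x - c *\<^sub>C x)"
  by (intro bounded_clinear_minus bounded_clinear_scale bounded_clinear_ident)

text \<open>Since the form of \<open>T\<close> is real on the diagonal, the shift alone produces the
  imaginary part of the form, of size \<open>\<bar>Im \<mu>\<bar>\<close> times the squared
  norm.\<close>

lemma self_adjoint_bounded_below_shift:
  assumes "self_adjoint T" "Im \<mu> \<noteq> 0"
  shows "bounded_below_op (\<lambda>x. T x - \<mu> *\<^sub>C x)"
proof -
  have "\<bar>Im \<mu>\<bar> * norm x \<le> norm (T x - \<mu> *\<^sub>C x)" for x
  proof (cases "x = 0")
    case False
    have "cinner (T x - \<mu> *\<^sub>C x) x = cinner (T x) x - \<mu> * of_real ((norm x)\<^sup>2)"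
      by (simp only: cinner_diff_left cinner_scaleC_left cinner_self)
    then have "\<bar>Im (cinner (T x - \<mu> *\<^sub>C x) x)\<bar> = \<bar>Im \<mu>\<bar> * (norm x)\<^sup>2"
      using self_adjoint_cinner_Im[OF assms(1), of x] by (simp add: abs_mult del: of_real_power)
    moreover have "\<bar>Im (cinner (T x - \<mu> *\<^sub>C x) x)\<bar> \<le> norm (T x - \<mu> *\<^sub>C x) * norm x"
      using abs_Im_le_cmod cinner_Cauchy_Schwarz order_trans by blast
    ultimately show ?thesis
      using False by (simp add: power2_eq_square)
  qed simp
  then show ?thesis
    using assms(2) unfolding bounded_below_op_def by (intro exI[of _ "\<bar>Im \<mu>\<bar>"]) auto
qed

text \<open>The lower bound makes the range closed and the kernel trivial. By symmetry a vector
  orthogonal to the range lies in the kernel, so the range is everything.\<close>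

lemma self_adjoint_bounded_below_invertible:
  fixes S :: "'a::chilbert_space \<Rightarrow> 'a"
  assumes "self_adjoint S" "bounded_below_op S"
  obtains R where "bounded_clinear R" "\<And>x. R (S x) = x" "\<And>x. S (R x) = x"
proof -
  have S: "bounded_clinear S" using assms(1) by (rule self_adjoint_bounded_clinear)
  obtain c where c: "c > 0" "\<And>x. c * norm x \<le> norm (S x)"
    using assms(2) unfolding bounded_below_op_def by blast
  have ker: "x = 0" if "S x = 0" for x
    using c(2)[of x] c(1) that by (simp add: mult_le_0_iff)
  have "complete (range S)"
    by (rule complete_isometric_image[OF c(1)])
      (use c(2) S in \<open>auto simp: bounded_clinear_def complete_UNIV\<close>)
  then have closed: "closed (range S)" by (rule complete_imp_closed)
  have surj: "\<exists>x. S x = y" for y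
  proof -
    obtain m where m: "m \<in> range S" "\<And>z. z \<in> range S \<Longrightarrow> cinner (y - m) z = 0"
    proof (rule orthogonal_projection_exists[OF closed, of y])
      show "0 \<in> range S" using rangeI[of S 0] by (simp add: bounded_clinear_zero[OF S])
      show "u + v \<in> range S" if "u \<in> range S" "v \<in> range S" for u v
        using that by (auto simp: bounded_clinear_add[OF S, symmetric])
      show "a *\<^sub>C u \<in> range S" if "u \<in> range S" for a u
        using that by (auto simp: bounded_clinear_scaleC[OF S, symmetric])
    qed blast
    \<comment> \<open>Orthogonality is tested on \<open>S (S (y - m))\<close>; symmetry moves one
      \<open>S\<close> to the left.\<close>
    have "cinner (S (y - m)) (S (y - m)) = 0"
      using m(2)[of "S (S (y - m))"] self_adjoint_cinner[OF assms(1)] by simp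
    then have "S (y - m) = 0" by (simp add: cinner_self)
    then have "y = m" using ker by fastforce
    then show ?thesis using m(1) by blast
  qed
  then obtain R where R: "\<And>y. S (R y) = y" by metis
  have inj: "u = v" if "S u = S v" for u v
    using ker[of "u - v"] that by (simp add: bounded_clinear_diff[OF S])
  show ?thesis
  proof (rule that)
    show "S (R x) = x" for x by (rule R)
    show "R (S x) = x" for x by (rule inj) (rule R)
    show "bounded_clinear R"
    proof (rule bounded_clinearI[where K = "1 / c"])
      fix x y a
      show "R (x + y) = R x + R y" by (rule inj) (simp add: R bounded_clinear_add[OF S])
      show "R (a *\<^sub>C x) = a *\<^sub>C R x" by (rule inj) (simp add: R bounded_clinear_scaleC[OF S])
      show "norm (R x) \<le> norm x * (1 / c)"
        using c(2)[of "R x"] c(1) by (simp add: R field_simps)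
    qed
  qed
qed

lemma not_bounded_below_in_spectrum:
  assumes "\<not> bounded_below_op (\<lambda>x. T x - \<mu> *\<^sub>C x)"
  shows "\<mu> \<in> op_spectrum T"
proof (rule ccontr)
  assume "\<mu> \<notin> op_spectrum T"
  then obtain S where S: "bounded_clinear S" "\<And>x. S (T x - \<mu> *\<^sub>C x) = x"
    unfolding op_spectrum_def by blast
  have pos: "0 \<le> onorm S" using S(1) by (rule bounded_clinear_onorm_pos)
  \<comment> \<open>Adding 1 keeps the denominator positive even when \<open>onorm S\<close> is 0,
    as on the zero space.\<close>
  have "1 / (onorm S + 1) * norm x \<le> norm (T x - \<mu> *\<^sub>C x)" for x
  proof -
    have "norm x \<le> onorm S * norm (T x - \<mu> *\<^sub>C x)"
      using bounded_clinear_bound[OF S(1), of "T x - \<mu> *\<^sub>C x"] by (simp add: S(2))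
    also have "\<dots> \<le> (onorm S + 1) * norm (T x - \<mu> *\<^sub>C x)"
      by (intro mult_right_mono) auto
    finally show ?thesis using pos by (simp add: field_simps)
  qed
  then have "bounded_below_op (\<lambda>x. T x - \<mu> *\<^sub>C x)"
    unfolding bounded_below_op_def using pos by (intro exI[of _ "1 / (onorm S + 1)"]) auto
  with assms show False ..
qed

lemma self_adjoint_real_spectrum_iff:
  assumes "self_adjoint T"
  shows "complex_of_real t \<in> op_spectrum T \<longleftrightarrow> \<not> bounded_below_op (\<lambda>x. T x - t *\<^sub>R x)"
proof
  assume t: "complex_of_real t \<in> op_spectrum T"
  show "\<not> bounded_below_op (\<lambda>x. T x - t *\<^sub>R x)"
  proof
    assume bb: "bounded_below_op (\<lambda>x. T x - t *\<^sub>R x)"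
    have "self_adjoint (\<lambda>x. T x - t *\<^sub>R x)"
      using assms bounded_clinear_shift[of T "of_real t"]
      by (simp add: self_adjoint_def scaleC_of_real cinner_algebra)
    then obtain R where "bounded_clinear R" "\<And>x. R (T x - t *\<^sub>R x) = x" "\<And>x. T (R x) - t *\<^sub>R R x = x"
      using self_adjoint_bounded_below_invertible bb by blast
    with t show False
      unfolding op_spectrum_def by (auto simp: scaleC_of_real)
  qed
next
  assume "\<not> bounded_below_op (\<lambda>x. T x - t *\<^sub>R x)"
  then show "complex_of_real t \<in> op_spectrum T"
    using not_bounded_below_in_spectrum[of T "of_real t"] by (simp add: scaleC_of_real)
qed

text \<open>For negative \<open>t\<close> the form of \<open>T - t\<close> is at least
  \<open>- t\<close> times the squared norm; for \<open>t\<close> above \<open>onorm T\<close> the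
  triangle inequality gives a lower bound. Thus the calculus only sees values on a compact interval
  of nonnegative numbers.\<close>

lemma positive_op_spectrum_bounds:
  assumes "positive_op T" "complex_of_real t \<in> op_spectrum T"
  shows "0 \<le> t" "t \<le> onorm T"
proof -
  have T: "self_adjoint T" "bounded_clinear T"
    using assms(1) positive_op_self_adjoint positive_op_bounded_clinear by blast+
  have nbb: "\<not> bounded_below_op (\<lambda>x. T x - t *\<^sub>R x)"
    using assms(2) self_adjoint_real_spectrum_iff[OF T(1)] by blast
  show "0 \<le> t"
  proof (rule ccontr)
    assume t: "\<not> 0 \<le> t"
    have "- t * norm x \<le> norm (T x - t *\<^sub>R x)" for x
    proof (cases "x = 0")
      case False
      have "cinner (T x - t *\<^sub>R x) x = cinner (T x) x - t *\<^sub>R of_real ((norm x)\<^sup>2)"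
        by (simp only: cinner_diff_left cinner_scaleR_left cinner_self)
      then have "- t * (norm x)\<^sup>2 \<le> Re (cinner (T x - t *\<^sub>R x) x)"
        using positive_op_nonneg[OF assms(1), of x] by (simp del: of_real_power)
      also have "\<dots> \<le> norm (T x - t *\<^sub>R x) * norm x"
        using complex_Re_le_cmod cinner_Cauchy_Schwarz order_trans by blast
      finally have "(- t * norm x) * norm x \<le> norm (T x - t *\<^sub>R x) * norm x"
        by (simp add: power2_eq_square)
      then show ?thesis
        using False by (simp only: mult_le_cancel_right) simp
    qed simp
    with nbb t show False
      unfolding bounded_below_op_def by (metis neg_0_less_iff_less not_le)
  qed
  show "t \<le> onorm T"
  proof (rule ccontr)
    assume t: "\<not> t \<le> onorm T"
    have "(t - onorm T) * norm x \<le> norm (T x - t *\<^sub>R x)" for x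
    proof -
      have "t * norm x = norm (t *\<^sub>R x)"
        using \<open>0 \<le> t\<close> by simp
      also have "\<dots> \<le> norm (T x - t *\<^sub>R x) + norm (T x)"
        using norm_triangle_ineq[of "t *\<^sub>R x - T x" "T x"] by (simp add: norm_minus_commute)
      also have "\<dots> \<le> norm (T x - t *\<^sub>R x) + onorm T * norm x"
        by (intro add_left_mono bounded_clinear_bound T)
      finally show ?thesis by (simp add: algebra_simps)
    qed
    with nbb t show False
      unfolding bounded_below_op_def by (metis diff_gt_0_iff_gt not_le)
  qed
qed

text \<open>For \<open>S = p(T)\<close> and \<open>m = \<parallel>S\<parallel>\<close> the operator \<open>S\<^sup>2 - m\<^sup>2\<close> is not bounded below.
  Factoring \<open>p\<^sup>2 - m\<^sup>2\<close> over the complex numbers turns this into a spectral point of \<open>T\<close>.\<close>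

lemma norm_sq_minus_not_bounded_below:
  fixes S :: "'a::chilbert_space \<Rightarrow> 'a"
  assumes S: "self_adjoint S" and x0: "(x0::'a) \<noteq> 0"
  shows "\<not> bounded_below_op (\<lambda>x. S (S x) - (onorm S)\<^sup>2 *\<^sub>R x)"
proof
  let ?m = "onorm S"
  have bS: "bounded_clinear S" using S by (rule self_adjoint_bounded_clinear)
  have m0: "0 \<le> ?m" using bS by (rule bounded_clinear_onorm_pos)
  assume "bounded_below_op (\<lambda>x. S (S x) - ?m\<^sup>2 *\<^sub>R x)"
  then obtain c where c: "c > 0" "\<And>x. c * norm x \<le> norm (S (S x) - ?m\<^sup>2 *\<^sub>R x)"
    unfolding bounded_below_op_def by blast
  \<comment> \<open>Expand the squared norm of \<open>S (S x) - ?m\<^sup>2 *\<^sub>R x\<close> and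
    estimate \<open>norm (S (S x))\<close> by \<open>?m * norm (S x)\<close>.\<close>
  have key: "c\<^sup>2 * (norm x)\<^sup>2 \<le> ?m\<^sup>2 * (?m\<^sup>2 * (norm x)\<^sup>2 - (norm (S x))\<^sup>2)" for x
  proof -
    have "c\<^sup>2 * (norm x)\<^sup>2 \<le> (norm (S (S x) - ?m\<^sup>2 *\<^sub>R x))\<^sup>2"
      using power_mono[OF c(2)[of x], of 2] c(1) by (simp add: power_mult_distrib)
    also have "\<dots> = (norm (S (S x)))\<^sup>2 + (?m\<^sup>2)\<^sup>2 * (norm x)\<^sup>2 - 2 * ?m\<^sup>2 * (norm (S x))\<^sup>2"
    proof -
      have "cinner (S (S x)) x = of_real ((norm (S x))\<^sup>2)"
        by (simp only: self_adjoint_cinner[OF S, of "S x"] cinner_self)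
      then show ?thesis
        unfolding norm_diff_sq cinner_scaleR_right by (simp add: power_mult_distrib del: of_real_power)
    qed
    also have "(norm (S (S x)))\<^sup>2 \<le> ?m\<^sup>2 * (norm (S x))\<^sup>2"
      using power_mono[OF bounded_clinear_bound[OF bS, of "S x"], of 2] by (simp add: power_mult_distrib)
    finally show ?thesis by (simp add: algebra_simps power2_eq_square)
  qed
  have "?m \<noteq> 0"
    using key[of x0] c(1) x0 by (auto simp: mult_le_0_iff)
  then have mp: "?m\<^sup>2 > 0" by simp
  \<comment> \<open>Solving \<open>key\<close> for the norm of \<open>S x\<close>: a lower bound
    \<open>c\<close> would force the norm of \<open>S\<close> down to \<open>sqrt ?k\<close>,
    strictly below \<open>?m\<close>.\<close>
  let ?k = "?m\<^sup>2 - c\<^sup>2 / ?m\<^sup>2"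
  have le: "(norm (S x))\<^sup>2 \<le> ?k * (norm x)\<^sup>2" for x
  proof -
    have "?m\<^sup>2 * (norm (S x))\<^sup>2 \<le> ?m\<^sup>2 * (?k * (norm x)\<^sup>2)"
      using key[of x] mp by (simp add: algebra_simps)
    then show ?thesis using mp by (simp only: mult_le_cancel_left_pos)
  qed
  have k0: "0 \<le> ?k"
    using order_trans[OF zero_le_power2 le[of x0]] x0 by (simp add: zero_le_mult_iff)
  have "norm (S x) \<le> sqrt ?k * norm x" for x
    using real_sqrt_le_mono[OF le[of x]] by (simp add: real_sqrt_mult)
  then have "?m \<le> sqrt ?k" using k0 by (intro onorm_bound) auto
  then have "?m\<^sup>2 \<le> ?k" using m0 k0 power_mono[of ?m "sqrt ?k" 2] by simp
  with c(1) mp show False by (simp add: field_simps)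
qed

lemma poly_op_norm_attained:
  fixes T :: "'a::chilbert_space \<Rightarrow> 'a"
  assumes "self_adjoint T" and x0: "(x0::'a) \<noteq> 0"
  obtains t where "complex_of_real t \<in> op_spectrum T" "\<bar>poly p t\<bar> = onorm (poly_op p T)"
proof -
  have T: "bounded_clinear T" using assms(1) by (rule self_adjoint_bounded_clinear)
  \<comment> \<open>The zero polynomial has every number as a root, so factoring says nothing in
    that case.\<close>
  have main: "\<exists>t. complex_of_real t \<in> op_spectrum T \<and> \<bar>poly p t\<bar> = onorm (poly_op p T)"
    if ne: "p * p - [:(onorm (poly_op p T))\<^sup>2:] \<noteq> 0" for p
  proof -
    let ?m = "onorm (poly_op p T)"
    let ?r = "p * p - [:?m\<^sup>2:]"
    let ?R = "map_poly complex_of_real ?r"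
    have "?R \<noteq> 0" using ne by (simp add: map_poly_eq_0_iff)
    moreover have "\<not> bounded_below_op (cpoly_op ?R T)"
      using norm_sq_minus_not_bounded_below[OF self_adjoint_poly_op[OF assms(1)] x0, of p]
      by (simp add: bounded_below_op_def cpoly_op_of_real[OF T] poly_op_diff poly_op_mult[OF T] poly_op_const)
    ultimately obtain \<mu> where \<mu>: "poly ?R \<mu> = 0" "\<not> bounded_below_op (\<lambda>x. T x - \<mu> *\<^sub>C x)"
      using bounded_below_cpoly_op[OF T] by blast
    then have "Im \<mu> = 0"
      using self_adjoint_bounded_below_shift[OF assms(1)] by blast
    then obtain t where t: "\<mu> = of_real t"
      by (metis complex_is_Real_iff Reals_cases)
    have "poly ?r t = 0" using \<mu>(1) unfolding t poly_map_of_real of_real_eq_0_iff .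
    then have "(poly p t)\<^sup>2 = ?m\<^sup>2" by (simp add: power2_eq_square)
    then have "\<bar>poly p t\<bar> = ?m"
      using bounded_clinear_onorm_pos[OF bounded_clinear_poly_op[OF T], of p] 
      by (auto simp: power2_eq_iff)
    then show ?thesis
      using not_bounded_below_in_spectrum[OF \<mu>(2)] t by blast
  qed
  show ?thesis
  proof (cases "p * p - [:(onorm (poly_op p T))\<^sup>2:] = 0")
    case False
    then show ?thesis using main that by blast
  next
    \<comment> \<open>Now \<open>\<bar>poly p t\<bar>\<close> equals the norm at every
      \<open>t\<close>, so any spectral point will do; \<open>main\<close> for the identity
      polynomial supplies one.\<close>
    case True
    then have "poly (p * p) t = poly [:(onorm (poly_op p T))\<^sup>2:] t" for t by simp
    then have "(poly p t)\<^sup>2 = (onorm (poly_op p T))\<^sup>2" for t by (simp add: power2_eq_square)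
    then have c: "\<bar>poly p t\<bar> = onorm (poly_op p T)" for t
      using bounded_clinear_onorm_pos[OF bounded_clinear_poly_op[OF T], of p] 
      by (simp add: power2_eq_iff abs_eq_iff')
    obtain t where "complex_of_real t \<in> op_spectrum T"
      using main[of "[:0, 1:]"] by auto
    then show ?thesis using that c by blast
  qed
qed

lemma poly_op_norm_le:
  fixes T :: "'a::chilbert_space \<Rightarrow> 'a"
  assumes "self_adjoint T" "\<And>t. complex_of_real t \<in> op_spectrum T \<Longrightarrow> \<bar>poly p t\<bar> \<le> M"
  shows "norm (poly_op p T x) \<le> M * norm x"
\<comment> \<open>A nonzero vector guarantees a spectral point; on the zero space the spectrum is
  empty and only \<open>x = 0\<close> occurs.\<close>
proof (cases "x = 0")
  case True
  then show ?thesis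
    by (simp add: bounded_clinear_zero bounded_clinear_poly_op self_adjoint_bounded_clinear assms(1))
next
  case False
  obtain t where "complex_of_real t \<in> op_spectrum T" "\<bar>poly p t\<bar> = onorm (poly_op p T)"
    using poly_op_norm_attained[OF assms(1) False] .
  then have "onorm (poly_op p T) \<le> M" using assms(2) by metis
  moreover have "norm (poly_op p T x) \<le> onorm (poly_op p T) * norm x"
    by (intro bounded_clinear_bound bounded_clinear_poly_op self_adjoint_bounded_clinear assms(1))
  ultimately show ?thesis
    by (meson mult_right_mono norm_ge_zero order_trans)
qed

section \<open>Functional calculus, square roots and the mixed Schwarz inequality\<close>

lemma polynomial_approximation:
  fixes \<phi> :: "real \<Rightarrow> real"
  assumes "continuous_on {0..} \<phi>"
  obtains p where "uniform_limit {0..K} (\<lambda>k. poly (p k)) \<phi> sequentially"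
proof -
  \<comment> \<open>The Bernstein theorem lives on the unit interval; \<open>max K 1\<close> makes
    the rescaling by \<open>L\<close> invertible for every \<open>K\<close>.\<close>
  define L where "L = max K 1"
  have L: "L > 0" "K \<le> L" by (auto simp: L_def)
  let ?h = "\<lambda>x. \<phi> (L * x)"
  have "continuous_on {0..1} ?h"
    by (rule continuous_on_compose2[OF assms]) (use L in \<open>auto intro!: continuous_intros\<close>)
  note B = Bernstein_Weierstrass[OF this]
  define b :: "nat \<Rightarrow> real poly" where "b n = (\<Sum>k\<le>n. smult (?h (real k / real n) * real (n choose k))
    (monom 1 k * [:1, -1:] ^ (n - k)))" for n
  have b: "poly (b n) x = (\<Sum>k\<le>n. ?h (real k / real n) * Bernstein n k x)" for n x
    by (simp add: b_def poly_sum poly_monom Bernstein_def mult.assoc)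
  let ?p = "\<lambda>n. pcompose (b n) [:0, 1 / L:]"
  have "uniform_limit {0..K} (\<lambda>k. poly (?p k)) \<phi> sequentially"
    unfolding uniform_limit_sequentially_iff
  proof (intro allI impI)
    fix e :: real assume "e > 0"
    then obtain N where N: "\<And>n x. N \<le> n \<Longrightarrow> x \<in> {0..1} \<Longrightarrow> \<bar>?h x - poly (b n) x\<bar> < e"
      using B unfolding b by blast
    have "dist (poly (?p n) x) (\<phi> x) < e" if "n \<ge> N" "x \<in> {0..K}" for n x
    proof -
      have "\<bar>?h (x / L) - poly (b n) (x / L)\<bar> < e"
        by (rule N) (use that L in auto)
      then show ?thesis
        using L by (simp add: poly_pcompose dist_real_def abs_minus_commute)
    qed
    then show "\<exists>N. \<forall>n\<ge>N. \<forall>x\<in>{0..K}. dist (poly (?p n) x) (\<phi> x) < e" by blast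
  qed
  then show ?thesis by (rule that)
qed

lemma poly_op_diff_norm_le:
  assumes "self_adjoint T"
    and "\<And>t. complex_of_real t \<in> op_spectrum T \<Longrightarrow> dist (poly p t) (\<phi> t) < d"
    and "\<And>t. complex_of_real t \<in> op_spectrum T \<Longrightarrow> dist (poly q t) (\<phi> t) < e"
  shows "norm (poly_op p T x - poly_op q T x) \<le> (d + e) * norm x"
  unfolding poly_op_diff[symmetric]
proof (rule poly_op_norm_le[OF assms(1)])
  fix t assume "complex_of_real t \<in> op_spectrum T"
  from assms(2)[OF this] assms(3)[OF this] show "\<bar>poly (p - q) t\<bar> \<le> d + e"
    unfolding dist_real_def by simp
qed

text \<open>Allowing \<open>K\<close> above \<open>onorm T\<close> lets one polynomial sequence
  serve two operators at once.\<close>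

lemma positive_op_uniform_limit_spectrum:
  assumes "positive_op T" "onorm T \<le> K" "uniform_limit {0..K} F \<phi> G"
  shows "uniform_limit {t. complex_of_real t \<in> op_spectrum T} F \<phi> G"
  using assms positive_op_spectrum_bounds[OF assms(1)]
  by (intro uniform_limit_on_subset[OF assms(3)]) force

lemma cont_fun_calc_exists:
  fixes T :: "'a::chilbert_space \<Rightarrow> 'a"
  assumes pos: "positive_op T" and cont: "continuous_on {0..} \<phi>"
  shows "\<exists>S. bounded_clinear S \<and>
    (\<forall>p. uniform_limit {t. complex_of_real t \<in> op_spectrum T} (\<lambda>k. poly (p k)) \<phi> sequentially
      \<longrightarrow> (\<lambda>k. onorm (\<lambda>x. poly_op (p k) T x - S x)) \<longlonglongrightarrow> 0)"
proof -
  have sa: "self_adjoint T" using pos by (rule positive_op_self_adjoint)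
  have T: "bounded_clinear T" using pos by (rule positive_op_bounded_clinear)
  let ?U = "\<lambda>p. uniform_limit {t. complex_of_real t \<in> op_spectrum T} (\<lambda>k. poly (p k)) \<phi> sequentially"
  obtain p where "uniform_limit {0..onorm T} (\<lambda>k. poly (p k)) \<phi> sequentially"
    using polynomial_approximation[OF cont] .
  then have Up: "?U p" by (rule positive_op_uniform_limit_spectrum[OF pos order_refl])
  \<comment> \<open>Comparing an arbitrary sequence \<open>q\<close> with the fixed \<open>p\<close>
    handles two matters at once: \<open>q = p\<close> gives the Cauchy property, general
    \<open>q\<close> gives independence of the chosen sequence.\<close>
  have near: "\<exists>N. \<forall>k\<ge>N. \<forall>l\<ge>N. \<forall>x. norm (poly_op (q k) T x - poly_op (p l) T x) \<le> e * norm x"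
    if Uq: "?U q" and e: "e > 0" for q e
  proof -
    obtain N where N: "\<And>n t. n \<ge> N \<Longrightarrow> complex_of_real t \<in> op_spectrum T \<Longrightarrow> dist (poly (q n) t) (\<phi> t) < e / 2"
      using Uq e unfolding uniform_limit_sequentially_iff by (metis half_gt_zero mem_Collect_eq)
    obtain M where M: "\<And>n t. n \<ge> M \<Longrightarrow> complex_of_real t \<in> op_spectrum T \<Longrightarrow> dist (poly (p n) t) (\<phi> t) < e / 2"
      using Up e unfolding uniform_limit_sequentially_iff by (metis half_gt_zero mem_Collect_eq)
    have "norm (poly_op (q k) T x - poly_op (p l) T x) \<le> e * norm x"
      if "k \<ge> max N M" "l \<ge> max N M" for k l x
      using poly_op_diff_norm_le[OF sa, of "q k" \<phi> "e / 2" "p l" "e / 2" x] N[of k] M[of l] that by simp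
    then show ?thesis by blast
  qed
  have "convergent (\<lambda>k. poly_op (p k) T x)" for x
  proof (intro Cauchy_convergent metric_CauchyI)
    fix e :: real assume "e > 0"
    \<comment> \<open>The added 1 gives \<open>?d * norm x < e\<close> also for
      \<open>x = 0\<close>.\<close>
    let ?d = "e / (norm x + 1)"
    have d: "?d > 0" using \<open>e > 0\<close> by (simp add: add_nonneg_pos)
    have "?d * norm x < e"
      using \<open>e > 0\<close> add_nonneg_pos[of "norm x" 1] by (simp add: field_simps)
    then show "\<exists>N. \<forall>k\<ge>N. \<forall>l\<ge>N. dist (poly_op (p k) T x) (poly_op (p l) T x) < e"
      using near[OF Up d] unfolding dist_norm by (meson le_less_trans)
  qed
  then obtain S where lim: "\<And>x. (\<lambda>k. poly_op (p k) T x) \<longlonglongrightarrow> S x"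
    unfolding convergent_def by metis
  have approx: "\<exists>N. \<forall>k\<ge>N. \<forall>x. norm (poly_op (q k) T x - S x) \<le> e * norm x"
    if Uq: "?U q" and e: "e > 0" for q e
  proof -
    obtain N where N: "\<And>k l x. k \<ge> N \<Longrightarrow> l \<ge> N \<Longrightarrow> norm (poly_op (q k) T x - poly_op (p l) T x) \<le> e * norm x"
      using near[OF Uq e] by blast
    have "norm (poly_op (q k) T x - S x) \<le> e * norm x" if "k \<ge> N" for k x
    proof (rule Lim_bounded)
      show "(\<lambda>l. norm (poly_op (q k) T x - poly_op (p l) T x)) \<longlonglongrightarrow> norm (poly_op (q k) T x - S x)"
        by (intro tendsto_intros lim)
      show "\<forall>l\<ge>N. norm (poly_op (q k) T x - poly_op (p l) T x) \<le> e * norm x"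
        using N that by blast
    qed
    then show ?thesis by blast
  qed
  have pk: "bounded_clinear (poly_op q T)" for q by (rule bounded_clinear_poly_op[OF T])
  have S: "bounded_clinear S"
  proof -
    obtain N where N: "\<And>x. norm (poly_op (p N) T x - S x) \<le> 1 * norm x"
      using approx[OF Up zero_less_one] by blast
    show ?thesis
    proof (rule bounded_clinearI[where K = "onorm (poly_op (p N) T) + 1"])
      fix x y c
      have "(\<lambda>k. poly_op (p k) T (x + y)) \<longlonglongrightarrow> S x + S y"
        unfolding bounded_clinear_add[OF pk] by (intro tendsto_intros lim)
      then show "S (x + y) = S x + S y" using lim LIMSEQ_unique by blast
      have "(\<lambda>k. poly_op (p k) T (c *\<^sub>C x)) \<longlonglongrightarrow> c *\<^sub>C S x"
        unfolding bounded_clinear_scaleC[OF pk]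
        by (intro bounded_clinear_tendsto[OF bounded_clinear_scale[OF bounded_clinear_ident]] lim)
      then show "S (c *\<^sub>C x) = c *\<^sub>C S x" using lim LIMSEQ_unique by blast
      have "norm (S x) \<le> norm (poly_op (p N) T x) + norm (poly_op (p N) T x - S x)"
        using norm_triangle_sub[of "S x" "poly_op (p N) T x"] by (simp add: norm_minus_commute)
      also have "\<dots> \<le> onorm (poly_op (p N) T) * norm x + 1 * norm x"
        by (intro add_mono N bounded_clinear_bound pk)
      finally show "norm (S x) \<le> norm x * (onorm (poly_op (p N) T) + 1)"
        by (simp add: algebra_simps)
    qed
  qed
  have "(\<lambda>k. onorm (\<lambda>x. poly_op (q k) T x - S x)) \<longlonglongrightarrow> 0" if Uq: "?U q" for q
  proof (rule LIMSEQ_I)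
    fix r :: real assume "r > 0"
    then obtain N where N: "\<And>k x. k \<ge> N \<Longrightarrow> norm (poly_op (q k) T x - S x) \<le> r / 2 * norm x"
      using approx[OF Uq, of "r / 2"] by auto
    have "norm (onorm (\<lambda>x. poly_op (q k) T x - S x) - 0) < r" if "k \<ge> N" for k
    proof -
      have "onorm (\<lambda>x. poly_op (q k) T x - S x) \<le> r / 2"
        by (rule onorm_bound) (use N[OF that] \<open>r > 0\<close> in auto)
      moreover have "0 \<le> onorm (\<lambda>x. poly_op (q k) T x - S x)"
        by (intro bounded_clinear_onorm_pos bounded_clinear_minus pk S)
      ultimately show ?thesis using \<open>r > 0\<close> by simp
    qed
    then show "\<exists>N. \<forall>k\<ge>N. norm (onorm (\<lambda>x. poly_op (q k) T x - S x) - 0) < r" by blast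
  qed
  with S show ?thesis by blast
qed

lemma tendsto_if_onorm_diff_tendsto_zero:
  assumes "\<And>k. bounded_clinear (F k)" "bounded_clinear S"
    and "(\<lambda>k. onorm (\<lambda>x. F k x - S x)) \<longlonglongrightarrow> 0"
  shows "(\<lambda>k. F k x) \<longlonglongrightarrow> S x"
proof (rule Lim_null[THEN iffD2], rule Lim_null_comparison)
  show "\<forall>\<^sub>F k in sequentially. norm (F k x - S x) \<le> onorm (\<lambda>x. F k x - S x) * norm x"
    by (intro always_eventually allI bounded_clinear_bound[OF bounded_clinear_minus] assms)
  show "(\<lambda>k. onorm (\<lambda>x. F k x - S x) * norm x) \<longlonglongrightarrow> 0"
    using tendsto_mult_right[OF assms(3), of "norm x"] by simp
qed

text \<open>The condition on \<open>S\<close> quantifies over all approximating sequences and would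
  be vacuous if there were none. Polynomial approximation supplies one, whose limit pins down
  \<open>S\<close>.\<close>

lemma cont_fun_calc_ex1:
  fixes T :: "'a::chilbert_space \<Rightarrow> 'a"
  assumes pos: "positive_op T" and cont: "continuous_on {0..} \<phi>"
  shows "\<exists>!S. bounded_clinear S \<and>
    (\<forall>p. uniform_limit {t. complex_of_real t \<in> op_spectrum T} (\<lambda>k. poly (p k)) \<phi> sequentially
      \<longrightarrow> (\<lambda>k. onorm (\<lambda>x. poly_op (p k) T x - S x)) \<longlonglongrightarrow> 0)"
proof (rule ex_ex1I)
  show "\<exists>S. bounded_clinear S \<and>
    (\<forall>p. uniform_limit {t. complex_of_real t \<in> op_spectrum T} (\<lambda>k. poly (p k)) \<phi> sequentially
      \<longrightarrow> (\<lambda>k. onorm (\<lambda>x. poly_op (p k) T x - S x)) \<longlonglongrightarrow> 0)"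
    by (rule cont_fun_calc_exists[OF assms])
next
  fix S S' :: "'a \<Rightarrow> 'a"
  assume S: "bounded_clinear S \<and>
    (\<forall>p. uniform_limit {t. complex_of_real t \<in> op_spectrum T} (\<lambda>k. poly (p k)) \<phi> sequentially
      \<longrightarrow> (\<lambda>k. onorm (\<lambda>x. poly_op (p k) T x - S x)) \<longlonglongrightarrow> 0)"
    and S': "bounded_clinear S' \<and>
    (\<forall>p. uniform_limit {t. complex_of_real t \<in> op_spectrum T} (\<lambda>k. poly (p k)) \<phi> sequentially
      \<longrightarrow> (\<lambda>k. onorm (\<lambda>x. poly_op (p k) T x - S' x)) \<longlonglongrightarrow> 0)"
  have pk: "bounded_clinear (poly_op q T)" for q
    by (rule bounded_clinear_poly_op[OF positive_op_bounded_clinear[OF pos]])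
  obtain p where "uniform_limit {0..onorm T} (\<lambda>k. poly (p k)) \<phi> sequentially"
    using polynomial_approximation[OF cont] .
  then have "uniform_limit {t. complex_of_real t \<in> op_spectrum T} (\<lambda>k. poly (p k)) \<phi> sequentially"
    by (rule positive_op_uniform_limit_spectrum[OF pos order_refl])
  then have "(\<lambda>k. poly_op (p k) T x) \<longlonglongrightarrow> S x" "(\<lambda>k. poly_op (p k) T x) \<longlonglongrightarrow> S' x" for x
    using S S' tendsto_if_onorm_diff_tendsto_zero[of "\<lambda>k. poly_op (p k) T", OF pk] by blast+
  then show "S = S'" using LIMSEQ_unique by blast
qed

lemma bounded_clinear_cont_fun_calc:
  assumes "positive_op T" "continuous_on {0..} \<phi>"
  shows "bounded_clinear (cont_fun_calc \<phi> T)"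
  using theI'[OF cont_fun_calc_ex1[OF assms]] unfolding cont_fun_calc_def by blast

lemma cont_fun_calc_tendsto:
  assumes "positive_op T" "continuous_on {0..} \<phi>" "onorm T \<le> K"
    and "uniform_limit {0..K} (\<lambda>k. poly (p k)) \<phi> sequentially"
  shows "(\<lambda>k. poly_op (p k) T x) \<longlonglongrightarrow> cont_fun_calc \<phi> T x"
proof (rule tendsto_if_onorm_diff_tendsto_zero[where F = "\<lambda>k. poly_op (p k) T" and S = "cont_fun_calc \<phi> T"])
  show "bounded_clinear (poly_op (p k) T)" for k
    by (intro bounded_clinear_poly_op positive_op_bounded_clinear assms)
  show "bounded_clinear (cont_fun_calc \<phi> T)"
    by (rule bounded_clinear_cont_fun_calc[OF assms(1,2)])
  show "(\<lambda>k. onorm (\<lambda>x. poly_op (p k) T x - cont_fun_calc \<phi> T x)) \<longlonglongrightarrow> 0"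
    using theI'[OF cont_fun_calc_ex1[OF assms(1,2)]]
      positive_op_uniform_limit_spectrum[OF assms(1,3,4)]
    unfolding cont_fun_calc_def by blast
qed

lemma self_adjoint_cont_fun_calc:
  assumes "positive_op T" "continuous_on {0..} \<phi>"
  shows "self_adjoint (cont_fun_calc \<phi> T)"
  unfolding self_adjoint_def
proof (intro conjI allI)
  show "bounded_clinear (cont_fun_calc \<phi> T)" by (rule bounded_clinear_cont_fun_calc[OF assms])
  fix x y
  obtain p where p: "uniform_limit {0..onorm T} (\<lambda>k. poly (p k)) \<phi> sequentially"
    using polynomial_approximation[OF assms(2)] .
  note lim = cont_fun_calc_tendsto[OF assms order_refl p]
  have "cinner (poly_op (p k) T x) y = cinner x (poly_op (p k) T y)" for k
    by (intro self_adjoint_cinner self_adjoint_poly_op positive_op_self_adjoint assms)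
  then have "(\<lambda>k. cinner (poly_op (p k) T x) y) \<longlonglongrightarrow> cinner x (cont_fun_calc \<phi> T y)"
    using tendsto_cinner[OF tendsto_const lim, of x y] by simp
  moreover have "(\<lambda>k. cinner (poly_op (p k) T x) y) \<longlonglongrightarrow> cinner (cont_fun_calc \<phi> T x) y"
    by (rule tendsto_cinner[OF lim tendsto_const])
  ultimately show "cinner (cont_fun_calc \<phi> T x) y = cinner x (cont_fun_calc \<phi> T y)"
    using LIMSEQ_unique by blast
qed

lemma cont_fun_calc_poly:
  assumes "positive_op T" "\<And>t. 0 \<le> t \<Longrightarrow> \<phi> t = poly p t"
  shows "cont_fun_calc \<phi> T x = poly_op p T x"
proof -
  have c: "continuous_on {0..} \<phi>"
    using assms(2) by (subst continuous_on_cong[OF refl, of _ _ "poly p"]) (auto intro: continuous_intros)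
  have "uniform_limit {0..onorm T} (\<lambda>k. poly p) \<phi> sequentially"
    using assms(2) by (simp add: uniform_limit_sequentially_iff)
  from cont_fun_calc_tendsto[OF assms(1) c order_refl this, of x]
  show ?thesis by (simp add: LIMSEQ_const_iff)
qed

lemma cont_fun_calc_ident:
  assumes "positive_op T" "\<And>t. 0 \<le> t \<Longrightarrow> \<phi> t = t"
  shows "cont_fun_calc \<phi> T x = T x"
  using cont_fun_calc_poly[OF assms(1), of \<phi> "[:0, 1:]" x] assms
  by (simp add: poly_op_ident positive_op_bounded_clinear)

lemma cont_fun_calc_const:
  assumes "positive_op T" "\<And>t. 0 \<le> t \<Longrightarrow> \<phi> t = c"
  shows "cont_fun_calc \<phi> T x = c *\<^sub>R x"
  using cont_fun_calc_poly[OF assms(1), of \<phi> "[:c:]" x] assms by (simp add: poly_op_const)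

lemma cont_fun_calc_add:
  assumes T: "positive_op T" and c: "continuous_on {0..} \<phi>" "continuous_on {0..} \<psi>"
    and eq: "\<And>t. 0 \<le> t \<Longrightarrow> \<eta> t = \<phi> t + \<psi> t"
  shows "cont_fun_calc \<eta> T x = cont_fun_calc \<phi> T x + cont_fun_calc \<psi> T x"
proof -
  let ?K = "onorm T"
  obtain p where p: "uniform_limit {0..?K} (\<lambda>k. poly (p k)) \<phi> sequentially"
    using polynomial_approximation[OF c(1)] .
  obtain q where q: "uniform_limit {0..?K} (\<lambda>k. poly (q k)) \<psi> sequentially"
    using polynomial_approximation[OF c(2)] .
  have c3: "continuous_on {0..} \<eta>"
    using eq c by (subst continuous_on_cong[OF refl, of _ _ "\<lambda>t. \<phi> t + \<psi> t"]) (auto intro: continuous_intros)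
  have "uniform_limit {0..?K} (\<lambda>k t. poly (p k) t + poly (q k) t) (\<lambda>t. \<phi> t + \<psi> t) sequentially"
    by (intro uniform_limit_add p q)
  then have "uniform_limit {0..?K} (\<lambda>k. poly (p k + q k)) \<eta> sequentially"
    unfolding uniform_limit_sequentially_iff by (simp add: eq)
  from cont_fun_calc_tendsto[OF T c3 order_refl this, of x]
  have "(\<lambda>k. poly_op (p k) T x + poly_op (q k) T x) \<longlonglongrightarrow> cont_fun_calc \<eta> T x"
    by (simp add: poly_op_add)
  moreover have "(\<lambda>k. poly_op (p k) T x + poly_op (q k) T x) \<longlonglongrightarrow> cont_fun_calc \<phi> T x + cont_fun_calc \<psi> T x"
    by (intro tendsto_add cont_fun_calc_tendsto[OF T _ order_refl] c p q)
  ultimately show ?thesis using LIMSEQ_unique by blast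
qed

text \<open>Only weak convergence is needed: \<open>\<langle>p\<^sub>k(T) q\<^sub>k(T) x, y\<rangle> = \<langle>q\<^sub>k(T) x, p\<^sub>k(T) y\<rangle>\<close>.\<close>

lemma cont_fun_calc_mult:
  assumes T: "positive_op T" and c: "continuous_on {0..} \<phi>" "continuous_on {0..} \<psi>"
    and eq: "\<And>t. 0 \<le> t \<Longrightarrow> \<eta> t = \<phi> t * \<psi> t"
  shows "cont_fun_calc \<eta> T x = cont_fun_calc \<phi> T (cont_fun_calc \<psi> T x)"
proof (rule cinner_eqI)
  fix y
  let ?K = "onorm T"
  have bT: "bounded_clinear T" using T by (rule positive_op_bounded_clinear)
  obtain p where p: "uniform_limit {0..?K} (\<lambda>k. poly (p k)) \<phi> sequentially"
    using polynomial_approximation[OF c(1)] .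
  obtain q where q: "uniform_limit {0..?K} (\<lambda>k. poly (q k)) \<psi> sequentially"
    using polynomial_approximation[OF c(2)] .
  have c3: "continuous_on {0..} \<eta>"
    using eq c by (subst continuous_on_cong[OF refl, of _ _ "\<lambda>t. \<phi> t * \<psi> t"]) (auto intro: continuous_intros)
  have bdd: "bounded (h ` {0..?K})" if "continuous_on {0..} h" for h :: "real \<Rightarrow> real"
    by (intro compact_imp_bounded compact_continuous_image continuous_on_subset[OF that]) auto
  have "uniform_limit {0..?K} (\<lambda>k t. poly (p k) t * poly (q k) t) (\<lambda>t. \<phi> t * \<psi> t) sequentially"
    by (intro uniform_lim_mult p q bdd c)
  then have "uniform_limit {0..?K} (\<lambda>k. poly (p k * q k)) \<eta> sequentially"
    unfolding uniform_limit_sequentially_iff by (simp add: eq)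
  from cont_fun_calc_tendsto[OF T c3 order_refl this, of x]
  have "(\<lambda>k. cinner (poly_op (p k) T (poly_op (q k) T x)) y) \<longlonglongrightarrow> cinner (cont_fun_calc \<eta> T x) y"
    by (intro tendsto_cinner tendsto_const) (simp add: poly_op_mult[OF bT])
  moreover have "cinner (poly_op (p k) T (poly_op (q k) T x)) y
    = cinner (poly_op (q k) T x) (poly_op (p k) T y)" for k
    by (intro self_adjoint_cinner self_adjoint_poly_op positive_op_self_adjoint T)
  moreover have "(\<lambda>k. cinner (poly_op (q k) T x) (poly_op (p k) T y))
      \<longlonglongrightarrow> cinner (cont_fun_calc \<psi> T x) (cont_fun_calc \<phi> T y)"
    by (intro tendsto_cinner cont_fun_calc_tendsto[OF T _ order_refl] c p q)
  ultimately have "cinner (cont_fun_calc \<eta> T x) y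
      = cinner (cont_fun_calc \<psi> T x) (cont_fun_calc \<phi> T y)"
    using LIMSEQ_unique by simp
  then show "cinner (cont_fun_calc \<eta> T x) y = cinner (cont_fun_calc \<phi> T (cont_fun_calc \<psi> T x)) y"
    by (simp add: self_adjoint_cinner[OF self_adjoint_cont_fun_calc[OF T c(1)]])
qed

text \<open>Polynomials intertwine exactly, so one sequence approximating on an interval that covers
  both spectra gives the claim in the limit.\<close>

lemma cont_fun_calc_intertwine:
  assumes S: "positive_op S" and T: "positive_op T" and X: "bounded_clinear X"
    and comm: "\<And>x. X (S x) = T (X x)" and c: "continuous_on {0..} \<phi>"
  shows "X (cont_fun_calc \<phi> S x) = cont_fun_calc \<phi> T (X x)"
proof -
  let ?K = "max (onorm S) (onorm T)"
  obtain p where p: "uniform_limit {0..?K} (\<lambda>k. poly (p k)) \<phi> sequentially"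
    using polynomial_approximation[OF c] .
  have "(\<lambda>k. X (poly_op (p k) S x)) \<longlonglongrightarrow> X (cont_fun_calc \<phi> S x)"
    by (intro bounded_clinear_tendsto[OF X] cont_fun_calc_tendsto[OF S c _ p]) simp
  moreover have "(\<lambda>k. X (poly_op (p k) S x)) \<longlonglongrightarrow> cont_fun_calc \<phi> T (X x)"
    unfolding poly_op_intertwine[OF positive_op_bounded_clinear[OF S] positive_op_bounded_clinear[OF T] X comm]
    by (intro cont_fun_calc_tendsto[OF T c _ p]) simp
  ultimately show ?thesis using LIMSEQ_unique by blast
qed

section \<open>Norm comparison and positive square roots\<close>

lemma self_adjoint_norm_sq:
  assumes "self_adjoint S"
  shows "cinner (S (S x)) x = of_real ((norm (S x))\<^sup>2)"
  by (simp only: self_adjoint_cinner[OF assms, of "S x"] cinner_self)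

lemma cont_fun_calc_norm_mono:
  assumes T: "positive_op T" and c: "continuous_on {0..} \<phi>" "continuous_on {0..} \<psi>"
    and le: "\<And>t. 0 \<le> t \<Longrightarrow> 0 \<le> \<phi> t" "\<And>t. 0 \<le> t \<Longrightarrow> \<phi> t \<le> \<psi> t"
  shows "norm (cont_fun_calc \<phi> T x) \<le> norm (cont_fun_calc \<psi> T x)"
proof -
  \<comment> \<open>The missing leg of a right triangle: the squared norms given by
    \<open>\<phi>\<close> and \<open>?\<rho>\<close> add up to the one given by
    \<open>\<psi>\<close>.\<close>
  let ?\<rho> = "\<lambda>t. sqrt ((\<psi> t)\<^sup>2 - (\<phi> t)\<^sup>2)"
  have cr: "continuous_on {0..} ?\<rho>" by (intro continuous_intros c)
  have sq: "cont_fun_calc (\<lambda>t. (h t)\<^sup>2) T x = cont_fun_calc h T (cont_fun_calc h T x)"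
    if "continuous_on {0..} h" for h
    by (rule cont_fun_calc_mult[OF T that that]) (simp add: power2_eq_square)
  have "cont_fun_calc (\<lambda>t. (\<psi> t)\<^sup>2) T x
      = cont_fun_calc (\<lambda>t. (\<phi> t)\<^sup>2) T x + cont_fun_calc (\<lambda>t. (?\<rho> t)\<^sup>2) T x"
  proof (rule cont_fun_calc_add[OF T])
    fix t :: real assume "0 \<le> t"
    then have "(\<phi> t)\<^sup>2 \<le> (\<psi> t)\<^sup>2" using le by (intro power_mono) auto
    then show "(\<psi> t)\<^sup>2 = (\<phi> t)\<^sup>2 + (?\<rho> t)\<^sup>2" by simp
  qed (intro continuous_intros c)+
  from arg_cong[OF this, of "\<lambda>v. Re (cinner v x)"]
  have "(norm (cont_fun_calc \<psi> T x))\<^sup>2 = (norm (cont_fun_calc \<phi> T x))\<^sup>2 + (norm (cont_fun_calc ?\<rho> T x))\<^sup>2"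
    unfolding cinner_add_left sq[OF c(1)] sq[OF c(2)] sq[OF cr]
      self_adjoint_norm_sq[OF self_adjoint_cont_fun_calc[OF T c(1)]]
      self_adjoint_norm_sq[OF self_adjoint_cont_fun_calc[OF T c(2)]]
      self_adjoint_norm_sq[OF self_adjoint_cont_fun_calc[OF T cr]]
    by (simp del: of_real_power)
  then have "(norm (cont_fun_calc \<phi> T x))\<^sup>2 \<le> (norm (cont_fun_calc \<psi> T x))\<^sup>2" by simp
  then show ?thesis by (rule power2_le_imp_le) simp
qed

lemma positive_op_square:
  assumes "self_adjoint S"
  shows "positive_op (\<lambda>x. S (S x))"
  unfolding positive_op_def self_adjoint_norm_sq[OF assms]
  using bounded_clinear_comp[of S S] assms by (auto simp: self_adjoint_def simp del: of_real_power)

lemma continuous_on_real_sqrt: "continuous_on A sqrt"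
  by (intro continuous_intros)

text \<open>The square root is the square of the self-adjoint fourth root, and squares of
  self-adjoint operators are positive.\<close>

lemma positive_op_cont_fun_calc_sqrt:
  assumes "positive_op T"
  shows "positive_op (cont_fun_calc sqrt T)"
proof -
  let ?\<psi> = "\<lambda>t::real. sqrt (sqrt t)"
  have c: "continuous_on {0..} ?\<psi>" by (intro continuous_intros)
  have "cont_fun_calc sqrt T = (\<lambda>x. cont_fun_calc ?\<psi> T (cont_fun_calc ?\<psi> T x))"
    by (rule ext, rule cont_fun_calc_mult[OF assms c c]) simp
  then show ?thesis
    using positive_op_square[OF self_adjoint_cont_fun_calc[OF assms c]] by simp
qed

lemma cont_fun_calc_sqrt_square:
  assumes "positive_op T"
  shows "cont_fun_calc sqrt T (cont_fun_calc sqrt T x) = T x"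
  using cont_fun_calc_mult[OF assms continuous_on_real_sqrt continuous_on_real_sqrt, of "\<lambda>t. t" x]
    cont_fun_calc_ident[OF assms, of "\<lambda>t. t" x] by simp

text \<open>If \<open>q\<^sub>k\<close> approximates the square root, then \<open>q\<^sub>k(t\<^sup>2)\<close> approximates the identity, so that
  every positive square root \<open>S\<close> of \<open>T\<close> is the limit of \<open>q\<^sub>k(S\<^sup>2) = q\<^sub>k(T)\<close>.\<close>

lemma positive_sqrt_unique:
  assumes T: "positive_op T" and S: "positive_op S" and sq: "\<And>x. S (S x) = T x"
  shows "S = cont_fun_calc sqrt T"
proof
  fix x
  have bS: "bounded_clinear S" using S by (rule positive_op_bounded_clinear)
  \<comment> \<open>The sequence must work for \<open>S\<close> after substituting the square, which
    needs \<open>onorm S \<le> K\<close>, and for \<open>T\<close> directly, which needs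
    \<open>onorm T \<le> K\<^sup>2\<close>; the latter follows from \<open>onorm T \<le> K\<close>
    and \<open>1 \<le> K\<close>.\<close>
  define K where "K = max (onorm S) (max 1 (onorm T))"
  have K: "onorm S \<le> K" "onorm T \<le> K" "1 \<le> K" by (auto simp: K_def)
  then have K2: "onorm T \<le> K\<^sup>2"
    using mult_left_mono[of 1 K K] unfolding power2_eq_square by linarith
  obtain q where q: "uniform_limit {0..K\<^sup>2} (\<lambda>k. poly (q k)) sqrt sequentially"
    using polynomial_approximation[OF continuous_on_real_sqrt] .
  have "uniform_limit {0..K} (\<lambda>k t. poly (q k) (t\<^sup>2)) (\<lambda>t. sqrt (t\<^sup>2)) sequentially"
    by (rule uniform_limit_compose'[OF q]) (auto intro: power_mono)
  then have "uniform_limit {0..K} (\<lambda>k. poly (pcompose (q k) [:0, 0, 1:])) (\<lambda>t. t) sequentially"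
    unfolding uniform_limit_sequentially_iff by (simp add: poly_pcompose power2_eq_square)
  from cont_fun_calc_tendsto[OF S continuous_on_id K(1) this, of x]
  have "(\<lambda>k. poly_op (q k) T x) \<longlonglongrightarrow> S x"
    by (simp add: poly_op_pcompose_square[OF bS] sq cont_fun_calc_ident[OF S])
  moreover have "(\<lambda>k. poly_op (q k) T x) \<longlonglongrightarrow> cont_fun_calc sqrt T x"
    by (rule cont_fun_calc_tendsto[OF T continuous_on_real_sqrt K2 q])
  ultimately show "S x = cont_fun_calc sqrt T x" using LIMSEQ_unique by blast
qed

lemma sqrt_op_eq:
  assumes "positive_op T"
  shows "sqrt_op T = cont_fun_calc sqrt T"
  unfolding sqrt_op_def
proof (rule the_equality)
  show "positive_op (cont_fun_calc sqrt T) \<and> cont_fun_calc sqrt T \<circ> cont_fun_calc sqrt T = T"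
    using assms by (auto simp: fun_eq_iff positive_op_cont_fun_calc_sqrt cont_fun_calc_sqrt_square)
  show "S = cont_fun_calc sqrt T" if "positive_op S \<and> S \<circ> S = T" for S
    using that by (intro positive_sqrt_unique[OF assms]) auto
qed

section \<open>Absolute values and the mixed Schwarz inequality\<close>

lemma positive_op_cadjoint_comp:
  assumes "bounded_clinear A"
  shows "positive_op (cadjoint A \<circ> A)"
proof -
  have "cinner (cadjoint A (A x)) x = of_real ((norm (A x))\<^sup>2)" for x
    unfolding cadjoint'[OF assms] by (rule cinner_self)
  then show ?thesis
    unfolding positive_op_def comp_def
    using bounded_clinear_comp[OF bounded_clinear_cadjoint[OF assms] assms]
    by (auto simp del: of_real_power)
qed

lemma abs_op_eq: "bounded_clinear A \<Longrightarrow> abs_op A = cont_fun_calc sqrt (cadjoint A \<circ> A)"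
  by (simp add: abs_op_def sqrt_op_eq positive_op_cadjoint_comp)

lemma positive_op_abs_op: "bounded_clinear A \<Longrightarrow> positive_op (abs_op A)"
  by (simp add: abs_op_eq positive_op_cont_fun_calc_sqrt positive_op_cadjoint_comp)

lemma abs_op_square: "bounded_clinear A \<Longrightarrow> abs_op A (abs_op A x) = cadjoint A (A x)"
  by (simp add: abs_op_eq cont_fun_calc_sqrt_square positive_op_cadjoint_comp)

text \<open>Both squared norms equal the form of \<open>cadjoint A \<circ> A\<close> at
  \<open>x\<close>. This stands in for the partial isometry of a polar decomposition.\<close>

lemma norm_abs_op:
  assumes "bounded_clinear A"
  shows "norm (abs_op A x) = norm (A x)"
proof -
  have "complex_of_real ((norm (abs_op A x))\<^sup>2) = of_real ((norm (A x))\<^sup>2)"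
    using self_adjoint_norm_sq[OF positive_op_self_adjoint[OF positive_op_abs_op[OF assms]], of x]
    unfolding abs_op_square[OF assms] cadjoint'[OF assms] cinner_self by simp
  then have "(norm (abs_op A x))\<^sup>2 = (norm (A x))\<^sup>2"
    using of_real_eq_iff by blast
  then show ?thesis by (simp add: power2_eq_iff_nonneg)
qed

text \<open>By associativity \<open>A\<close> intertwines \<open>cadjoint A \<circ> A\<close> with
  \<open>A \<circ> cadjoint A\<close>, and the calculus carries this over to their square
  roots.\<close>

lemma abs_op_intertwine:
  assumes A: "bounded_clinear A"
  shows "A (abs_op A x) = abs_op (cadjoint A) (A x)"
proof -
  have A': "bounded_clinear (cadjoint A)" using A by (rule bounded_clinear_cadjoint)
  show ?thesis
    unfolding abs_op_eq[OF A] abs_op_eq[OF A']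
    by (rule cont_fun_calc_intertwine[OF positive_op_cadjoint_comp[OF A] positive_op_cadjoint_comp[OF A'] A])
      (simp_all add: A cadjoint_cadjoint continuous_on_real_sqrt)
qed

text \<open>With \<open>P = |A|\<close>, \<open>Q = |A\<^sup>*|\<close> and \<open>h = 1/(f + \<epsilon>)\<close> we have
  \<open>\<langle>A x, y\<rangle> = \<langle>(f(P) + \<epsilon>) x, h(P) A\<^sup>* y\<rangle>\<close>. Since \<open>h(P) A\<^sup>* = A\<^sup>* h(Q)\<close>, the second vector has the norm of
  \<open>Q h(Q) y\<close>, and \<open>t h(t) \<le> g(t)\<close>. This avoids the polar decomposition of \<open>A\<close>.\<close>

lemma mixed_Cauchy_Schwarz:
  assumes A: "bounded_clinear A"
    and cf: "continuous_on {0..} f" and cg: "continuous_on {0..} g"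
    and f0: "\<And>t. t \<ge> 0 \<Longrightarrow> f t \<ge> 0" and g0: "\<And>t. t \<ge> 0 \<Longrightarrow> g t \<ge> 0"
    and fg: "\<And>t. t \<ge> 0 \<Longrightarrow> f t * g t = t"
  shows "cmod (cinner (A x) y)
    \<le> norm (cont_fun_calc f (abs_op A) x) * norm (cont_fun_calc g (abs_op (cadjoint A)) y)"
proof -
  let ?P = "abs_op A" and ?Q = "abs_op (cadjoint A)"
  have A': "bounded_clinear (cadjoint A)" using A by (rule bounded_clinear_cadjoint)
  have P: "positive_op ?P" and Q: "positive_op ?Q" using A A' by (auto intro: positive_op_abs_op)
  let ?a = "norm (cont_fun_calc f ?P x)" and ?b = "norm (cont_fun_calc g ?Q y)"
  \<comment> \<open>The product condition makes \<open>f\<close> positive for positive arguments,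
    but \<open>f 0\<close> may be 0. The shift by \<open>e\<close> makes the reciprocal continuous
    and is removed by letting \<open>e\<close> tend to 0 from the right.\<close>
  have eps: "cmod (cinner (A x) y) \<le> (?a + e * norm x) * ?b" if e: "e > 0" for e
  proof -
    let ?F = "\<lambda>t. f t + e" and ?h = "\<lambda>t. 1 / (f t + e)"
    have F0: "?F t > 0" if "t \<ge> 0" for t using f0[OF that] e by simp
    have cF: "continuous_on {0..} ?F" by (intro continuous_intros cf)
    have ch: "continuous_on {0..} ?h"
      by (intro continuous_intros cf) (use F0 in force)
    have cth: "continuous_on {0..} (\<lambda>t. t * ?h t)"
      by (intro continuous_on_mult continuous_on_id ch)
    have inv: "cont_fun_calc ?F ?P (cont_fun_calc ?h ?P v) = v" for v
    proof -
      have "cont_fun_calc (\<lambda>t. 1) ?P v = cont_fun_calc ?F ?P (cont_fun_calc ?h ?P v)"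
        using F0 by (intro cont_fun_calc_mult[OF P cF ch]) force
      then show ?thesis using cont_fun_calc_const[OF P, of "\<lambda>t. 1" 1 v] by simp
    qed
    have Fx: "cont_fun_calc ?F ?P x = cont_fun_calc f ?P x + e *\<^sub>R x"
      using cont_fun_calc_add[OF P cf continuous_on_const[of "{0..}" e], of ?F x]
        cont_fun_calc_const[OF P, of "\<lambda>t. e" e x] by simp
    have "norm (cont_fun_calc ?h ?P (cadjoint A y)) = norm (cadjoint A (cont_fun_calc ?h ?Q y))"
      by (subst cont_fun_calc_intertwine[OF Q P A' _ ch])
        (simp_all add: abs_op_intertwine[OF A'] cadjoint_cadjoint[OF A])
    also have "\<dots> = norm (?Q (cont_fun_calc ?h ?Q y))"
      by (simp add: norm_abs_op[OF A'])
    also have "?Q (cont_fun_calc ?h ?Q y) = cont_fun_calc (\<lambda>t. t * ?h t) ?Q y"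
      using cont_fun_calc_mult[OF Q continuous_on_id ch, of "\<lambda>t. t * ?h t" y]
        cont_fun_calc_ident[OF Q, of "\<lambda>t. t"] by simp
    also have "norm (cont_fun_calc (\<lambda>t. t * ?h t) ?Q y) \<le> ?b"
    proof (rule cont_fun_calc_norm_mono[OF Q cth cg])
      fix t :: real assume t: "0 \<le> t"
      show "0 \<le> t * ?h t" using t F0[OF t] by simp
      have "t \<le> g t * (f t + e)" using fg[OF t] g0[OF t] e by (simp add: algebra_simps)
      then show "t * ?h t \<le> g t" using F0[OF t] by (simp add: divide_le_eq)
    qed
    finally have 1: "norm (cont_fun_calc ?h ?P (cadjoint A y)) \<le> ?b" .
    have "cinner (A x) y = cinner x (cont_fun_calc ?F ?P (cont_fun_calc ?h ?P (cadjoint A y)))"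
      by (simp add: cadjoint[OF A] inv)
    also have "\<dots> = cinner (cont_fun_calc ?F ?P x) (cont_fun_calc ?h ?P (cadjoint A y))"
      by (simp add: self_adjoint_cinner[OF self_adjoint_cont_fun_calc[OF P cF]])
    finally have "cmod (cinner (A x) y)
        \<le> norm (cont_fun_calc ?F ?P x) * norm (cont_fun_calc ?h ?P (cadjoint A y))"
      using cinner_Cauchy_Schwarz by metis
    also have "\<dots> \<le> (?a + e * norm x) * ?b"
    proof (intro mult_mono 1)
      show "norm (cont_fun_calc ?F ?P x) \<le> ?a + e * norm x"
        unfolding Fx using norm_triangle_ineq[of "cont_fun_calc f ?P x" "e *\<^sub>R x"] e by simp
    qed (use e in auto)
    finally show ?thesis .
  qed
  have "((\<lambda>e. (?a + e * norm x) * ?b) \<longlongrightarrow> (?a + 0 * norm x) * ?b) (at_right 0)"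
    by (intro tendsto_intros)
  then have "cmod (cinner (A x) y) \<le> (?a + 0 * norm x) * ?b"
    by (rule tendsto_lowerbound) (use eps in \<open>auto simp: eventually_at_right_less intro: eventually_at_rightI[of 0 1]\<close>)
  then show ?thesis by simp
qed

section \<open>Numerical radius of block operators\<close>

text \<open>A real \<open>Sup\<close> dominates its elements only when the set is bounded
  above.\<close>

lemma numerical_radius_bdd_above:
  fixes T :: "'a::chilbert_space \<Rightarrow> 'a"
  assumes "bounded_clinear T"
  shows "bdd_above (insert 0 {cmod (cinner (T x) x) | x. norm x = 1})"
proof (rule bdd_aboveI[where M = "onorm T"])
  have "cmod (cinner (T x) x) \<le> onorm T" if "norm x = 1" for x
    using cinner_Cauchy_Schwarz[of "T x" x] bounded_clinear_bound[OF assms, of x] that by simp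
  then show "y \<le> onorm T" if "y \<in> insert 0 {cmod (cinner (T x) x) | x. norm x = 1}" for y
    using that bounded_clinear_onorm_pos[OF assms] by auto
qed

lemma numerical_radius_ge_unit:
  assumes "bounded_clinear T" "norm x = 1"
  shows "cmod (cinner (T x) x) \<le> numerical_radius T"
  unfolding numerical_radius_def
  by (rule cSup_upper[OF _ numerical_radius_bdd_above[OF assms(1)]]) (use assms(2) in blast)

lemma numerical_radius_nonneg: "bounded_clinear T \<Longrightarrow> 0 \<le> numerical_radius T"
  unfolding numerical_radius_def by (rule cSup_upper[OF _ numerical_radius_bdd_above]) auto

lemma numerical_radius_le:
  fixes T :: "'a::chilbert_space \<Rightarrow> 'a"
  assumes "0 \<le> M" "\<And>x. norm x = 1 \<Longrightarrow> cmod (cinner (T x) x) \<le> M"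
  shows "numerical_radius T \<le> M"
  unfolding numerical_radius_def by (rule cSup_least) (use assms in auto)

lemma numerical_radius_ge:
  assumes "bounded_clinear T"
  shows "cmod (cinner (T x) x) \<le> numerical_radius T * (norm x)\<^sup>2"
proof (cases "x = 0")
  case False
  have "cmod (cinner (T ((1 / norm x) *\<^sub>R x)) ((1 / norm x) *\<^sub>R x)) \<le> numerical_radius T"
    by (rule numerical_radius_ge_unit[OF assms]) (use False in simp)
  then show ?thesis
    using False by (simp add: bounded_clinear_scaleR[OF assms] cinner_algebra power2_eq_square field_simps)
qed (simp add: bounded_clinear_zero[OF assms])

text \<open>A crude bound by the sum of all entry moduli is enough: it makes the supremum for the
  triangular matrix a genuine upper bound.\<close>

lemma bounded_clinear_matrix_vector_mult:
  fixes M :: "complex ^ 'n::finite ^ 'n"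
  shows "bounded_clinear ((*v) M)"
proof (rule bounded_clinearI[where K = "\<Sum>i\<in>UNIV. \<Sum>j\<in>UNIV. cmod (M $ i $ j)"])
  fix x y :: "complex ^ 'n" and c :: complex
  show "M *v (x + y) = M *v x + M *v y" by (rule matrix_vector_right_distrib)
  show "M *v (c *\<^sub>C x) = c *\<^sub>C (M *v x)"
    by (simp add: vec_eq_iff matrix_vector_mult_def scaleC_vec_def scaleC_complex_def
        sum_distrib_left mult.left_commute)
  have "norm (M *v x) \<le> (\<Sum>i\<in>UNIV. norm ((M *v x) $ i))"
    unfolding norm_vec_def by (rule L2_set_le_sum) simp
  also have "\<dots> \<le> (\<Sum>i\<in>UNIV. \<Sum>j\<in>UNIV. cmod (M $ i $ j) * norm x)"
    unfolding matrix_vector_mult_def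
    by (auto intro!: sum_mono sum_norm_le simp: norm_mult mult_left_mono Finite_Cartesian_Product.norm_nth_le)
  finally show "norm (M *v x) \<le> norm x * (\<Sum>i\<in>UNIV. \<Sum>j\<in>UNIV. cmod (M $ i $ j))"
    by (simp add: sum_distrib_left mult.commute)
qed

section \<open>From pairs of blocks to the triangular matrix\<close>

lemma cinner_sum_left: "cinner (sum h I) y = (\<Sum>i\<in>I. cinner (h i) y)"
  by (induction I rule: infinite_finite_induct) (simp_all add: cinner_add_left)

text \<open>By self-adjointness the left side is the quadratic form of the sum of the two squares,
  so Cauchy-Schwarz applies.\<close>

lemma sum_squares_le_onorm:
  assumes F: "self_adjoint F" and G: "self_adjoint G"
  shows "(norm (F x))\<^sup>2 + (norm (G x))\<^sup>2 \<le> onorm (\<lambda>x. (F ^^ 2) x + (G ^^ 2) x) * (norm x)\<^sup>2"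
proof -
  let ?S = "\<lambda>x. (F ^^ 2) x + (G ^^ 2) x"
  have S: "?S = (\<lambda>x. F (F x) + G (G x))" by (simp add: numeral_2_eq_2)
  have bS: "bounded_clinear ?S"
    unfolding S using F G
    by (intro bounded_clinear_plus bounded_clinear_comp[of F F] bounded_clinear_comp[of G G]
        self_adjoint_bounded_clinear)
  have "cinner (?S x) x = cinner (F (F x)) x + cinner (G (G x)) x"
    by (simp add: cinner_add_left numeral_2_eq_2)
  then have "cinner (?S x) x = of_real ((norm (F x))\<^sup>2 + (norm (G x))\<^sup>2)"
    unfolding self_adjoint_norm_sq[OF F] self_adjoint_norm_sq[OF G] by simp
  then have "(norm (F x))\<^sup>2 + (norm (G x))\<^sup>2 = cmod (cinner (?S x) x)"
    by (simp only: norm_of_real) simp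
  also have "\<dots> \<le> norm (?S x) * norm x" by (rule cinner_Cauchy_Schwarz)
  also have "\<dots> \<le> onorm ?S * norm x * norm x"
    by (intro mult_right_mono bounded_clinear_bound bS) simp
  finally show ?thesis by (simp add: power2_eq_square mult.assoc)
qed

text \<open>Cauchy-Schwarz for \<open>(a, d)\<close> and \<open>(b, c)\<close>, by the Lagrange
  identity. In the application \<open>a\<close> and \<open>d\<close> depend on one vector,
  \<open>b\<close> and \<open>c\<close> on the other.\<close>

lemma two_products_le_sqrt:
  fixes a b c d :: real
  shows "a * b + c * d \<le> sqrt (a\<^sup>2 + d\<^sup>2) * sqrt (b\<^sup>2 + c\<^sup>2)"
proof -
  have "(a\<^sup>2 + d\<^sup>2) * (b\<^sup>2 + c\<^sup>2) = (a * b + c * d)\<^sup>2 + (a * c - b * d)\<^sup>2"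
    by (simp add: algebra_simps power2_eq_square)
  then show ?thesis
    unfolding real_sqrt_mult[symmetric] by (intro real_le_rsqrt) simp
qed

lemma offdiag_pair_le:
  fixes A :: "'n \<Rightarrow> 'n \<Rightarrow> 'a::chilbert_space \<Rightarrow> 'a"
  assumes A: "\<And>i j. bounded_clinear (A i j)"
    and cf: "continuous_on {0..} f" and cg: "continuous_on {0..} g"
    and f0: "\<And>t. t \<ge> 0 \<Longrightarrow> f t \<ge> 0" and g0: "\<And>t. t \<ge> 0 \<Longrightarrow> g t \<ge> 0"
    and fg: "\<And>t. t \<ge> 0 \<Longrightarrow> f t * g t = t"
  shows "cmod (cinner (A i j y) x) + cmod (cinner (A j i x) y)
    \<le> offdiag_coeff f g A i j * norm y * norm x"
proof -
  have sa: "self_adjoint (cont_fun_calc \<phi> (abs_op B))" if "bounded_clinear B" "continuous_on {0..} \<phi>"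
    for \<phi> and B :: "'a \<Rightarrow> 'a"
    by (intro self_adjoint_cont_fun_calc positive_op_abs_op that)
  let ?F = "\<lambda>i j. cont_fun_calc f (abs_op (A i j))"
  let ?G = "\<lambda>i j. cont_fun_calc g (abs_op (cadjoint (A i j)))"
  let ?N = "\<lambda>i j. onorm (\<lambda>x. (?F i j ^^ 2) x + (?G j i ^^ 2) x)"
  have F: "self_adjoint (?F i j)" and G: "self_adjoint (?G i j)" for i j
    by (intro sa A cf cg bounded_clinear_cadjoint)+
  have N: "sqrt ((norm (?F i j z))\<^sup>2 + (norm (?G j i z))\<^sup>2) \<le> sqrt (?N i j) * norm z" for i j z
    using real_sqrt_le_mono[OF sum_squares_le_onorm[OF F[of i j] G[of j i], of z]]
    by (simp add: real_sqrt_mult)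
  have "cmod (cinner (A i j y) x) + cmod (cinner (A j i x) y)
      \<le> norm (?F i j y) * norm (?G i j x) + norm (?F j i x) * norm (?G j i y)"
    by (intro add_mono mixed_Cauchy_Schwarz[OF A cf cg f0 g0 fg])
  also have "\<dots> \<le> sqrt ((norm (?F i j y))\<^sup>2 + (norm (?G j i y))\<^sup>2)
      * sqrt ((norm (?G i j x))\<^sup>2 + (norm (?F j i x))\<^sup>2)"
    by (rule two_products_le_sqrt)
  also have "\<dots> \<le> (sqrt (?N i j) * norm y) * (sqrt (?N j i) * norm x)"
    \<comment> \<open>The last fact gives the nonnegativity of \<open>sqrt (?N i j) * norm y\<close>
      that monotonicity of the product requires.\<close>
    using N[of i j y] N[of j i x] order_trans[OF real_sqrt_ge_zero N[of i j y]]
    by (intro mult_mono) (auto simp: add.commute)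
  finally show ?thesis by (simp add: offdiag_coeff_def mult.assoc mult.left_commute)
qed

lemma sum_pairs_upper_triangle:
  fixes B :: "'n::{finite,linorder} \<Rightarrow> 'n \<Rightarrow> real"
  shows "(\<Sum>i\<in>UNIV. \<Sum>j\<in>UNIV. B i j)
    = (\<Sum>i\<in>UNIV. \<Sum>j\<in>UNIV. if i = j then B i i else if i < j then B i j + B j i else 0)"
proof -
  \<comment> \<open>The strictly lower part, which exchanging the summations reflects onto the upper
    triangle.\<close>
  let ?L = "\<lambda>i j. if j < i then B i j else 0"
  have "(\<Sum>i\<in>UNIV. \<Sum>j\<in>UNIV. B i j)
      = (\<Sum>i\<in>UNIV. \<Sum>j\<in>UNIV. (if i = j then B i i else if i < j then B i j else 0) + ?L i j)"
    by (intro sum.cong refl) auto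
  also have "\<dots> = (\<Sum>i\<in>UNIV. \<Sum>j\<in>UNIV. if i = j then B i i else if i < j then B i j else 0)
      + (\<Sum>i\<in>UNIV. \<Sum>j\<in>UNIV. ?L i j)"
    by (simp add: sum.distrib)
  also have "(\<Sum>i\<in>UNIV. \<Sum>j\<in>UNIV. ?L i j) = (\<Sum>i\<in>UNIV. \<Sum>j\<in>UNIV. ?L j i)"
    by (rule sum.swap)
  also have "(\<Sum>i\<in>UNIV. \<Sum>j\<in>UNIV. if i = j then B i i else if i < j then B i j else 0)
      + (\<Sum>i\<in>UNIV. \<Sum>j\<in>UNIV. ?L j i)
      = (\<Sum>i\<in>UNIV. \<Sum>j\<in>UNIV. if i = j then B i i else if i < j then B i j + B j i else 0)"
    unfolding sum.distrib[symmetric] by (intro sum.cong refl) auto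
  finally show ?thesis .
qed

theorem theorem2p2:
  fixes A :: "'n::{finite,linorder} \<Rightarrow> 'n \<Rightarrow> 'a::chilbert_space \<Rightarrow> 'a"
    and f g :: "real \<Rightarrow> real"
  assumes "\<And>i j. bounded_clinear (A i j)"
    and "continuous_on {0..} f" and "continuous_on {0..} g"
    and "\<And>t. t \<ge> 0 \<Longrightarrow> f t \<ge> 0" and "\<And>t. t \<ge> 0 \<Longrightarrow> g t \<ge> 0"
    and "\<And>t. t \<ge> 0 \<Longrightarrow> f t * g t = t"
  shows "numerical_radius (block_op A)
    \<le> numerical_radius ((*v) (\<chi> i j.
          if i = j then complex_of_real (numerical_radius (A i i))
          else if i < j then complex_of_real (offdiag_coeff f g A i j)
          else 0))"
    (is "_ \<le> numerical_radius ((*v) ?M)")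
proof (rule numerical_radius_le)
  have M: "bounded_clinear ((*v) ?M)" by (rule bounded_clinear_matrix_vector_mult)
  show "0 \<le> numerical_radius ((*v) ?M)" by (rule numerical_radius_nonneg[OF M])
  fix x :: "('a, 'n) vec" assume x: "norm x = 1"
  let ?B = "\<lambda>i j. cmod (cinner (A i j (x $ j)) (x $ i))"
  let ?m = "\<lambda>i j. if i = j then numerical_radius (A i i) else if i < j then offdiag_coeff f g A i j else 0"
  let ?n = "\<lambda>i. norm (x $ i)"
  \<comment> \<open>Replacing each component by its norm keeps the total norm 1 and makes the form
    of \<open>?M\<close> a real sum.\<close>
  define u :: "(complex, 'n) vec" where "u = (\<chi> i. of_real (?n i))"
  have u: "norm u = 1"
    using x by (simp add: u_def norm_vec_def)
  have "cinner (?M *v u) u = of_real (\<Sum>i\<in>UNIV. \<Sum>j\<in>UNIV. ?m i j * ?n j * ?n i)"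
    unfolding cinner_vec_def matrix_vector_mult_def u_def cinner_complex_def of_real_sum
    by (auto simp: sum_distrib_right intro!: sum.cong)
  then have quad: "(\<Sum>i\<in>UNIV. \<Sum>j\<in>UNIV. ?m i j * ?n j * ?n i) \<le> cmod (cinner (?M *v u) u)"
    by (simp only: norm_of_real abs_ge_self)
  have "cmod (cinner (block_op A x) x) \<le> (\<Sum>i\<in>UNIV. \<Sum>j\<in>UNIV. ?B i j)"
    unfolding cinner_vec_def block_op_def
    by (auto simp: cinner_sum_left intro!: sum_norm_le)
  also have "\<dots> = (\<Sum>i\<in>UNIV. \<Sum>j\<in>UNIV. if i = j then ?B i i else if i < j then ?B i j + ?B j i else 0)"
    by (rule sum_pairs_upper_triangle)
  also have "\<dots> \<le> (\<Sum>i\<in>UNIV. \<Sum>j\<in>UNIV. ?m i j * ?n j * ?n i)"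
  proof (intro sum_mono)
    fix i j
    have "?B i i \<le> numerical_radius (A i i) * ?n i * ?n i"
      using numerical_radius_ge[OF assms(1)] by (simp add: power2_eq_square mult.assoc)
    moreover have "?B i j + ?B j i \<le> offdiag_coeff f g A i j * ?n j * ?n i"
      using assms by (rule offdiag_pair_le)
    ultimately show "(if i = j then ?B i i else if i < j then ?B i j + ?B j i else 0)
        \<le> ?m i j * ?n j * ?n i"
      by (cases "i = j") auto
  qed
  also note quad
  also have "cmod (cinner (?M *v u) u) \<le> numerical_radius ((*v) ?M)"
    by (rule numerical_radius_ge_unit[OF M u])
  finally show "cmod (cinner (block_op A x) x) \<le> numerical_radius ((*v) ?M)" .
qed

end
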